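(* Let $m\ge 2$, $M=\{1,\ldots,m\}$, $I^m=[0,1]^m$, and let $\mathcal{M}$ be a family of nonempty subsets of $M$ that is closed under passing to supersets: if $U\subset V\subset M$ and $U\in\mathcal{M}$, then $V\in\mathcal{M}$. Define real coefficients $a_U$, $U\in\mathcal{M}$, recurrently by $$\sum_{V\subset U,\ V\in\mathcal{M}}a_V=1\quad\text{for all } U\in\mathcal{M},$$ and for $\mathbf{x}=(x_1,\ldots,x_m)$, $\boldsymbol{\xi}=(\xi_1,\ldots,\xi_m)\in I^m$ put $$\mathcal{G}_{\mathcal{M}}(\mathbf{x},\boldsymbol{\xi})=\prod_{j=1}^m\min(x_j,\xi_j)-\sum_{U\in\mathcal{M}}a_U\prod_{j\in M\setminus U}\min(x_j,\xi_j)\prod_{i\in U}x_i\xi_i .$$ Then $\mathcal{G}_{\mathcal{M}}$ is the Green function of the boundary-value problem consisting of the equation $(-1)^m\lambda\,\dfrac{\partial^{2m}\Omega}{\partial x_1^2\cdots\partial x_m^2}=\mu$ together with the boundary conditions determined by $\mathcal{M}$. That is, for every $\boldsymbol{\xi}\in(0,1)^m$ the function $\mathbf{x}\mapsto\mathcal{G}_{\mathcal{M}}(\mathbf{x},\boldsymbol{\xi})$ satisfies: (i) $(-1)^m\dfrac{\partial^{2m}\mathcal{G}_{\mathcal{M}}(\mathbf{x},\boldsymbol{\xi})}{\partial x_1^2\cdots\partial x_m^2}=\delta(\mathbf{x}-\boldsymbol{\xi})$ in the sense of distributions, where $\delta$ is the Dirac function; (ii) $\mathcal{G}_{\mathcal{M}}(\cdot,\boldsymbol{\xi})\in\mathbf{H}^m_{\mathcal{M}}$,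 i.e. it belongs to $\mathbf{H}^m$ (in particular it vanishes when $x_j=0$ for some $j$) and $\mathcal{G}_{\mathcal{M}}(\mathbf{x},\boldsymbol{\xi})|_{\mathbf{x}_U=\mathbf{1}}=0$ for every $U\in\mathcal{M}$; (iii) the natural boundary conditions: for every nonempty $V\subset M$ with $V\notin\mathcal{M}$, writing $l=|V|$, $k=m-l$, $V^c=M\setminus V$, $$\frac{\partial^{l+2k}\mathcal{G}_{\mathcal{M}}(\mathbf{x},\boldsymbol{\xi})}{\partial\mathbf{x}_V\,\partial\mathbf{x}^2_{V^c}}\Big|_{\mathbf{x}_V=\mathbf{1}}=0 .$$
   Context: For $U\subset M$, $\mathbf{x}_U=(x_i: i\in U)$, and $|_{\mathbf{x}_U=\mathbf{1}}$ means that $x_i$ is set equal to $1$ for all $i\in U$ (the other coordinates being arbitrary in $[0,1]$). Empty products equal $1$. Let $\mathbf{C}^m_0=\{\Omega\in\mathbf{C}^m(I^m):\Omega(\mathbf{x})|_{x_j=0}=0,\ j=1,\ldots,m\}$ (real-valued functions) with scalar product $(\Omega_1,\Omega_2)=\int_{I^m}\omega_1(\mathbf{x})\omega_2(\mathbf{x})\,d\mathbf{x}$, where $\omega_i=\partial^m\Omega_i/\partial x_1\cdots\partial x_m$. $\mathbf{H}^m$ is the closure (completion) of $\mathbf{C}^m_0$ in the norm induced by this scalar product; it embeds into $\mathbf{C}(I^m)$, so its elements are regarded as continuous functions on $I^m$ vanishing whenever some $x_j=0$. Define $$\mathbf{H}^m_{\mathcal{M}}=\{\Omega\in\mathbf{H}^m:\Omega(\mathbf{x})|_{\mathbf{x}_U=\mathbf{1}}=0,\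 U\in\mathcal{M}\}.$$ For $V=\{i_1,\ldots,i_l\}$ and $V^c=M\setminus V=\{j_1,\ldots,j_k\}$, $l+k=m$, the symbol $\partial\mathbf{x}_V\partial\mathbf{x}^2_{V^c}$ stands for $\partial x_{i_1}\cdots\partial x_{i_l}\,\partial x_{j_1}^2\cdots\partial x_{j_k}^2$. The boundary-value problem is: find $\Omega\in\mathbf{H}^m_{\mathcal{M}}$ such that $(-1)^m\lambda\,\partial^{2m}\Omega/\partial x_1^2\cdots\partial x_m^2=\mu$ in the sense of distributions ($\mu$ a finite measure on $I^m$, $\lambda$ a Lagrange multiplier fixed by the normalization $\int_{I^m}\Omega\,d\mu=1$), with the natural boundary conditions $\frac{\partial^{l+2k}\Omega}{\partial\mathbf{x}_V\partial\mathbf{x}^2_{V^c}}|_{\mathbf{x}_V=\mathbf{1}}=0$ for all nonempty $V\notin\mathcal{M}$. The Green function of this problem is the function of $(\mathbf{x},\boldsymbol{\xi})$ which, as a function of $\mathbf{x}$, satisfies the boundary conditions and equation (i). Interpretation: distributions in (i) are on the open cube $(0,1)^m$. In (iii), the mixed first-order derivative $\partial^l/\partial\mathbf{x}_V$ is evaluated at $\mathbf{x}_V=\mathbf{1}$ (one-sided derivatives at $1$; $\mathcal{G}_{\mathcal{M}}(\cdot,\boldsymbol{\xi})$ is smooth in $\mathbf{x}_V$ near $\mathbf{x}_V=\mathbf{1}$ since $\xi_j<1$), giving a continuous function of $\mathbf{x}_{V^c}$, and the remaining second-order derivatives in $\mathbf{x}_{V^c}$ are taken in the sense of distributions on $(0,1)^k$.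 *)

theory Defs
  imports "HOL-Analysis.Analysis"
begin

text \<open>
  For a finite index set \<open>K\<close>, a point of \<open>\<real>\<^sup>K\<close> is an extensional function on \<open>K\<close>, as in
  \<^const>\<open>PiE\<close> and \<^const>\<open>PiM\<close>.  Coordinates can then be split into \<open>V\<close> and its complement
  within a single statement.  For \<open>K = {}\<close> there is exactly one point.
\<close>

definition unit_cube :: "nat set \<Rightarrow> (nat \<Rightarrow> real) set" where
  "unit_cube K = PiE K (\<lambda>_. {0..1})"

definition open_cube :: "nat set \<Rightarrow> (nat \<Rightarrow> real) set" where
  "open_cube K = PiE K (\<lambda>_. {0<..<1})"

abbreviation lebesgue_PiM :: "nat set \<Rightarrow> (nat \<Rightarrow> real) measure" where
  "lebesgue_PiM K \<equiv> PiM K (\<lambda>_. lborel)"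

subsection \<open>Partial derivatives\<close>

text \<open>
  The derivative is taken within \<open>{0..1}\<close>: it is one-sided on the faces of the cube, and it is
  the usual two-sided derivative when \<open>0 < x j < 1\<close>.
\<close>

definition partial_deriv ::
  "nat \<Rightarrow> ((nat \<Rightarrow> real) \<Rightarrow> real) \<Rightarrow> (nat \<Rightarrow> real) \<Rightarrow> real" where
  "partial_deriv j f x = vector_derivative (\<lambda>t. f (x(j := t))) (at (x j) within {0..1})"

text \<open>
  First order in each variable of \<open>V\<close>.  The increasing order of the indices is only a
  convention, since this is applied where the mixed derivatives are continuous.
\<close>

definition mixed_deriv ::
  "nat set \<Rightarrow> ((nat \<Rightarrow> real) \<Rightarrow> real) \<Rightarrow> (nat \<Rightarrow> real) \<Rightarrow> real" where
  "mixed_deriv V f = foldr partial_deriv (sorted_list_of_set V) f"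

text \<open>
  \<open>C_class r V A f\<close>: all iterated partial derivatives of \<open>f\<close> of order at most \<open>r\<close> in the variables
  of \<open>V\<close> exist and are continuous on \<open>A\<close>.  It is only used for \<open>A\<close> relatively open in
  \<^term>\<open>unit_cube K\<close>, \<open>V \<subseteq> K\<close>, so that the values of \<open>f\<close> outside \<open>A\<close> are irrelevant.
\<close>

primrec C_class ::
  "nat \<Rightarrow> nat set \<Rightarrow> (nat \<Rightarrow> real) set \<Rightarrow> ((nat \<Rightarrow> real) \<Rightarrow> real) \<Rightarrow> bool" where
  "C_class 0 V A f \<longleftrightarrow> continuous_on A f"
| "C_class (Suc r) V A f \<longleftrightarrow> continuous_on A f \<and>
     (\<forall>j\<in>V. (\<forall>x\<in>A. (\<lambda>t. f (x(j := t))) differentiable (at (x j) within {0..1})) \<and>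
        C_class r V A (partial_deriv j f))"

subsection \<open>The Hilbert space\<close>

definition C0_space :: "nat set \<Rightarrow> ((nat \<Rightarrow> real) \<Rightarrow> real) set" where
  "C0_space K = {\<Omega>. C_class (card K) K (unit_cube K) \<Omega> \<and>
     (\<forall>x\<in>unit_cube K. \<forall>j\<in>K. x j = 0 \<longrightarrow> \<Omega> x = 0)}"

definition H_inner ::
  "nat set \<Rightarrow> ((nat \<Rightarrow> real) \<Rightarrow> real) \<Rightarrow> ((nat \<Rightarrow> real) \<Rightarrow> real) \<Rightarrow> real" where
  "H_inner K \<Omega>\<^sub>1 \<Omega>\<^sub>2 =
     (LINT x:unit_cube K|lebesgue_PiM K. mixed_deriv K \<Omega>\<^sub>1 x * mixed_deriv K \<Omega>\<^sub>2 x)"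

definition H_norm :: "nat set \<Rightarrow> ((nat \<Rightarrow> real) \<Rightarrow> real) \<Rightarrow> real" where
  "H_norm K \<Omega> = sqrt (H_inner K \<Omega> \<Omega>)"

text \<open>
  The norm dominates the supremum norm on \<^const>\<open>C0_space\<close>, so the completion embeds into the
  continuous functions: a norm-Cauchy sequence is identified with its uniform limit.  As everywhere
  in this theory, only the values on the cube matter.
\<close>

definition H_space :: "nat set \<Rightarrow> ((nat \<Rightarrow> real) \<Rightarrow> real) set" where
  "H_space K = {\<Omega>. \<exists>F :: nat \<Rightarrow> (nat \<Rightarrow> real) \<Rightarrow> real.
     (\<forall>n. F n \<in> C0_space K) \<and>
     (\<forall>e>0. \<exists>N. \<forall>p\<ge>N. \<forall>q\<ge>N. H_norm K (\<lambda>x. F p x - F q x) < e) \<and>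
     uniform_limit (unit_cube K) F \<Omega> sequentially}"

definition H_space_bc :: "nat set \<Rightarrow> nat set set \<Rightarrow> ((nat \<Rightarrow> real) \<Rightarrow> real) set" where
  "H_space_bc K \<M> = {\<Omega> \<in> H_space K.
     \<forall>U\<in>\<M>. \<forall>x\<in>unit_cube K. (\<forall>i\<in>U. x i = 1) \<longrightarrow> \<Omega> x = 0}"

subsection \<open>Distributions on the open cube\<close>

definition test_fun :: "nat set \<Rightarrow> ((nat \<Rightarrow> real) \<Rightarrow> real) \<Rightarrow> bool" where
  "test_fun K \<phi> \<longleftrightarrow> (\<forall>r. C_class r K (open_cube K) \<phi>) \<and>
     (\<exists>C. compact C \<and> C \<subseteq> open_cube K \<and> (\<forall>x\<in>open_cube K - C. \<phi> x = 0))"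

text \<open>Distributions are represented by functionals, compared on test functions only.\<close>

type_synonym distr_fun = "((nat \<Rightarrow> real) \<Rightarrow> real) \<Rightarrow> real"

definition regular_distr :: "nat set \<Rightarrow> ((nat \<Rightarrow> real) \<Rightarrow> real) \<Rightarrow> distr_fun" where
  "regular_distr K f \<phi> = (LINT x:open_cube K|lebesgue_PiM K. f x * \<phi> x)"

definition dirac_distr :: "(nat \<Rightarrow> real) \<Rightarrow> distr_fun" where
  "dirac_distr \<xi> \<phi> = \<phi> \<xi>"

definition distr_partial :: "nat \<Rightarrow> distr_fun \<Rightarrow> distr_fun" where
  "distr_partial j T \<phi> = - T (partial_deriv j \<phi>)"

text \<open>Second order in each variable of \<open>K\<close>.\<close>

definition distr_second_deriv :: "nat set \<Rightarrow> distr_fun \<Rightarrow> distr_fun" where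
  "distr_second_deriv K T =
     foldr (\<lambda>j S. distr_partial j (distr_partial j S)) (sorted_list_of_set K) T"

subsection \<open>Natural boundary conditions\<close>

text \<open>
  The first conjunct, smoothness in the variables of \<open>V\<close> near \<open>x\<^sub>V = 1\<close>, makes the mixed
  derivative on that face meaningful; it is then a continuous function of the remaining variables.
\<close>

definition natural_bc :: "nat set \<Rightarrow> nat set \<Rightarrow> ((nat \<Rightarrow> real) \<Rightarrow> real) \<Rightarrow> bool" where
  "natural_bc K V \<Omega> \<longleftrightarrow>
     (\<exists>\<epsilon>>0. \<forall>r. C_class r V {x \<in> unit_cube K. \<forall>i\<in>V. 1 - \<epsilon> < x i} \<Omega>) \<and>
     (\<forall>\<phi>. test_fun (K - V) \<phi> \<longrightarrow>
        distr_second_deriv (K - V)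
          (regular_distr (K - V) (\<lambda>y. mixed_deriv V \<Omega> (\<lambda>i. if i \<in> V then 1 else y i))) \<phi> = 0)"

subsection \<open>The Green function\<close>

definition green ::
  "nat set \<Rightarrow> nat set set \<Rightarrow> (nat set \<Rightarrow> real) \<Rightarrow> (nat \<Rightarrow> real) \<Rightarrow> (nat \<Rightarrow> real) \<Rightarrow> real" where
  "green K \<M> a x \<xi> = (\<Prod>j\<in>K. min (x j) (\<xi> j)) -
     (\<Sum>U\<in>\<M>. a U * (\<Prod>j\<in>K - U. min (x j) (\<xi> j)) * (\<Prod>i\<in>U. x i * \<xi> i))"

end

theory Submission
  imports Defs
begin

text \<open>
  With \<open>a \<emptyset> = -1\<close> the Green function is a linear combination, over \<open>U \<in> \<M> \<union> {\<emptyset>}\<close>, of products of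
  one-variable kernels: \<open>t \<mapsto> t \<xi>\<^sub>j\<close> for \<open>j \<in> U\<close> and \<open>t \<mapsto> min t \<xi>\<^sub>j\<close> for \<open>j \<notin> U\<close>, whose second derivatives on
  \<open>(0, 1)\<close> are \<open>0\<close> and \<open>-\<delta>\<^sub>\<xi>\<^sub>j\<close>.  Integrating by parts in one variable at a time, only the term \<open>U = \<emptyset>\<close>
  survives in the equation.  Taking one derivative at \<open>x\<^sub>V = 1\<close> kills the terms with \<open>V \<not>\<subseteq> U\<close>,
  and the remaining second derivatives kill those with \<open>V \<subset> U\<close>; the term \<open>U = V\<close> is
  absent when \<open>V \<notin> \<M>\<close>.  On the face \<open>x\<^sub>U = 1\<close> the product belonging to \<open>W\<close> depends on \<open>W - U\<close> only,
  and the defining recurrence says that the coefficients with \<open>W - U = T\<close> sum to \<open>1\<close> for \<open>T = \<emptyset>\<close> and to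
  \<open>0\<close> otherwise.  Membership in the Hilbert space follows by replacing \<open>min t \<xi>\<^sub>j\<close> with a
  smooth minimum whose derivative, a logistic function, is bounded and converges pointwise.
\<close>

subsection \<open>Locality of partial derivatives\<close>

text \<open>Partial derivatives at a point of \<open>A\<close> then depend only on the values of the function on \<open>A\<close>.\<close>

definition slice_open :: "nat set \<Rightarrow> (nat \<Rightarrow> real) set \<Rightarrow> bool" where
  "slice_open V A \<longleftrightarrow> (\<forall>x\<in>A. \<forall>j\<in>V. x j \<in> {0..1} \<and>
     (\<forall>\<^sub>F t in nhds (x j). t \<in> {0..1} \<longrightarrow> x(j := t) \<in> A))"

lemma slice_openD:
  assumes "slice_open V A" "x \<in> A" "j \<in> V"
  shows "x j \<in> {0..1}" "\<forall>\<^sub>F t in nhds (x j). t \<in> {0..1} \<longrightarrow> x(j := t) \<in> A"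
  using assms unfolding slice_open_def by blast+

lemma slice_open_unit_cube:
  assumes "V \<subseteq> K"
  shows "slice_open V (unit_cube K)"
  unfolding slice_open_def
proof (intro ballI conjI always_eventually allI impI)
  fix x j assume x: "x \<in> unit_cube K" and j: "j \<in> V"
  with assms have "j \<in> K" by blast
  with x show "x j \<in> {0..1}" by (auto simp: unit_cube_def dest: PiE_mem)
  fix t :: real assume "t \<in> {0..1}"
  with x have "x(j := t) \<in> PiE (insert j K) (\<lambda>_. {0..1})"
    unfolding unit_cube_def by (intro PiE_fun_upd)
  with \<open>j \<in> K\<close> show "x(j := t) \<in> unit_cube K"
    by (simp add: unit_cube_def insert_absorb)
qed

text \<open>Moving one coordinate is a continuous map into the product topology, so an open
  condition survives small moves. With \<open>f\<close> the identity, it serves to leave a compact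
  support and to localise near a face of the cube.\<close>

lemma slice_open_inter_continuous:
  assumes "slice_open V A" and "continuous_on UNIV f" and "open S"
  shows "slice_open V {x \<in> A. f x \<in> S}"
  unfolding slice_open_def
proof (intro ballI conjI)
  fix x j assume x: "x \<in> {x \<in> A. f x \<in> S}" and j: "j \<in> V"
  then show "x j \<in> {0..1}" using slice_openD(1)[OF assms(1)] by blast
  have c: "continuous_on UNIV (\<lambda>t. x(j := t))"
  proof (rule continuous_on_coordinatewise_then_product)
    show "continuous_on UNIV (\<lambda>t. (x(j := t)) i)" for i
      by (cases "i = j") auto
  qed
  have "open ((\<lambda>t. f (x(j := t))) -` S)"
    using continuous_on_compose2[OF assms(2) c] assms(3)
    by (auto simp: continuous_on_open_vimage)
  then have "\<forall>\<^sub>F t in nhds (x j). f (x(j := t)) \<in> S"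
    using x by (auto simp: eventually_nhds)
  moreover have "\<forall>\<^sub>F t in nhds (x j). t \<in> {0..1} \<longrightarrow> x(j := t) \<in> A"
    using slice_openD(2)[OF assms(1) _ j] x by blast
  ultimately show "\<forall>\<^sub>F t in nhds (x j). t \<in> {0..1} \<longrightarrow> x(j := t) \<in> {x \<in> A. f x \<in> S}"
    by eventually_elim blast
qed

lemma partial_deriv_cong:
  assumes "slice_open V A" "x \<in> A" "j \<in> V" and eq: "\<And>y. y \<in> A \<Longrightarrow> f y = g y"
  shows "partial_deriv j f x = partial_deriv j g x"
  unfolding partial_deriv_def
  using slice_openD[OF assms(1-3)]
  by (intro vector_derivative_cong_eq) (auto elim!: eventually_mono simp: eq)

text \<open>The derivatives inside \<open>C_class\<close> are total functions, while explicit
  formulas for them hold on \<open>A\<close> only. Locality lets the induction replace each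
  derivative by its formula.\<close>

lemma C_class_cong:
  assumes "slice_open V A" and "C_class r V A f" and "\<And>y. y \<in> A \<Longrightarrow> f y = g y"
  shows "C_class r V A g"
  using assms(2,3)
proof (induction r arbitrary: f g)
  case 0
  then show ?case by (simp cong: continuous_on_cong)
next
  case (Suc r)
  have "(\<lambda>t. g (x(j := t))) differentiable (at (x j) within {0..1})" if x: "x \<in> A" and j: "j \<in> V" for x j
  proof -
    have "(\<lambda>t. f (x(j := t))) differentiable (at (x j) within {0..1})"
      using Suc.prems x j by simp
    then obtain D where "((\<lambda>t. f (x(j := t))) has_derivative D) (at (x j) within {0..1})"
      by (auto simp: differentiable_def)
    moreover have "\<forall>\<^sub>F t in at (x j) within {0..1}. f (x(j := t)) = g (x(j := t))"
      using slice_openD(2)[OF assms(1) x j] Suc.prems(2)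
      by (auto simp: eventually_at_filter elim!: eventually_mono)
    ultimately have "((\<lambda>t. g (x(j := t))) has_derivative D) (at (x j) within {0..1})"
      by (rule has_derivative_transform_eventually)
        (use slice_openD(1)[OF assms(1) x j] x Suc.prems(2) in auto)
    then show ?thesis by (auto simp: differentiable_def)
  qed
  moreover have "C_class r V A (partial_deriv j g)" if j: "j \<in> V" for j
  proof (rule Suc.IH)
    show "C_class r V A (partial_deriv j f)" using Suc.prems(1) j by simp
    show "partial_deriv j f y = partial_deriv j g y" if "y \<in> A" for y
      using partial_deriv_cong[OF assms(1) that j] Suc.prems(2) by blast
  qed
  moreover have "continuous_on A g"
    using Suc.prems continuous_on_cong[of A A f g] by simp
  ultimately show ?case by simp
qed

subsection \<open>Families of mixed derivatives\<close>

text \<open>\<open>D \<alpha>\<close> plays the role of the partial derivative of \<open>D (\<lambda>_. 0)\<close> with multi-index \<open>\<alpha>\<close>.\<close>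

definition jet :: "nat set \<Rightarrow> (nat \<Rightarrow> real) set \<Rightarrow>
    ((nat \<Rightarrow> nat) \<Rightarrow> (nat \<Rightarrow> real) \<Rightarrow> real) \<Rightarrow> bool" where
  "jet V A D \<longleftrightarrow> (\<forall>\<alpha>. continuous_on A (D \<alpha>) \<and> (\<forall>j\<in>V. \<forall>x\<in>A.
     ((\<lambda>t. D \<alpha> (x(j := t))) has_real_derivative D (\<alpha>(j := Suc (\<alpha> j))) x) (at (x j) within {0..1})))"

lemma jet_partial_deriv:
  assumes "jet V A D" "slice_open V A" "x \<in> A" "j \<in> V"
  shows "partial_deriv j (D \<alpha>) x = D (\<alpha>(j := Suc (\<alpha> j))) x"
proof -
  have "((\<lambda>t. D \<alpha> (x(j := t))) has_vector_derivative D (\<alpha>(j := Suc (\<alpha> j))) x)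
      (at (x j) within {0..1})"
    using assms unfolding jet_def by (simp add: has_real_derivative_iff_has_vector_derivative)
  then show ?thesis
    unfolding partial_deriv_def using slice_openD(1)[OF assms(2-4)]
    by (intro vector_derivative_within_closed_interval) auto
qed

text \<open>The induction runs over all multi-indices at once: a derivative of a member of the
  family is again a member, so first derivatives already give every order of smoothness.\<close>

lemma jet_C_class:
  assumes "jet V A D" "slice_open V A"
  shows "C_class r V A (D \<alpha>)"
proof (induction r arbitrary: \<alpha>)
  case 0
  then show ?case using assms by (simp add: jet_def)
next
  case (Suc r)
  have "C_class r V A (partial_deriv j (D \<alpha>))" if j: "j \<in> V" for j
    by (rule C_class_cong[OF assms(2) Suc[of "\<alpha>(j := Suc (\<alpha> j))"]])
      (rule jet_partial_deriv[OF assms _ j, symmetric])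
  moreover have "(\<lambda>t. D \<alpha> (x(j := t))) differentiable (at (x j) within {0..1})"
    if "x \<in> A" "j \<in> V" for x j
    using assms(1) that unfolding jet_def real_differentiable_def by blast
  ultimately show ?case
    using assms(1) by (simp add: jet_def)
qed

text \<open>Each variable taken from the list raises a fresh entry of the multi-index from 0 to 1;
  distinctness of the list keeps the entries from growing further.\<close>

lemma mixed_deriv_jet:
  assumes D: "jet V A D" and A: "slice_open V A" and f: "\<And>x. x \<in> A \<Longrightarrow> f x = D (\<lambda>_. 0) x"
    and "finite V" and x: "x \<in> A"
  shows "mixed_deriv V f x = D (\<lambda>j. if j \<in> V then 1 else 0) x"
proof -
  have "foldr partial_deriv js f x = D (\<lambda>j. if j \<in> set js then 1 else 0) x"
    if "distinct js" "set js \<subseteq> V" "x \<in> A" for js x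
    using that
  proof (induction js arbitrary: x)
    case Nil
    then show ?case using f by simp
  next
    case (Cons i js)
    have "partial_deriv i (foldr partial_deriv js f) x
        = partial_deriv i (D (\<lambda>j. if j \<in> set js then 1 else 0)) x"
      using Cons by (intro partial_deriv_cong[OF A]) auto
    also have "\<dots> = D ((\<lambda>j. if j \<in> set js then 1 else 0)(i := 1)) x"
      using Cons.prems by (subst jet_partial_deriv[OF D A]) auto
    also have "(\<lambda>j. if j \<in> set js then 1 else 0)(i := 1)
        = (\<lambda>j. if j \<in> set (i # js) then 1 else (0::nat))"
      by auto
    finally show ?case by simp
  qed
  from this[of "sorted_list_of_set V" x] show ?thesis
    using assms(4,5) by (simp add: mixed_deriv_def)
qed

lemma jet_diff: "jet V A D \<Longrightarrow> jet V A E \<Longrightarrow> jet V A (\<lambda>\<alpha> x. D \<alpha> x - E \<alpha> x)"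
  unfolding jet_def by (auto intro!: continuous_on_diff DERIV_diff)

lemma jet_sum:
  "(\<And>u. u \<in> S \<Longrightarrow> jet V A (D u)) \<Longrightarrow> jet V A (\<lambda>\<alpha> x. \<Sum>u\<in>S. c u * D u \<alpha> x)"
  unfolding jet_def by (auto intro!: continuous_on_sum continuous_on_mult_left DERIV_sum DERIV_cmult)

lemma continuous_on_prod_coordinates:
  assumes "\<And>j. j \<in> K \<Longrightarrow> continuous_on {0..1} (g j)"
  shows "continuous_on (unit_cube K) (\<lambda>x. \<Prod>j\<in>K. g j (x j) :: real)"
  by (intro continuous_on_prod continuous_on_compose2[OF assms]
      continuous_on_subset[OF continuous_on_product_coordinates])
    (auto simp: unit_cube_def PiE_iff)

text \<open>Differentiability is asked only of the factors with index in \<open>V\<close>; the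
  others are merely continuous. This admits the kinked kernel min in the variables outside
  \<open>V\<close> in the natural boundary conditions.\<close>

lemma jet_prod:
  assumes "finite K" "V \<subseteq> K"
    and cont: "\<And>j k. j \<in> K \<Longrightarrow> continuous_on {0..1} (g j k)"
    and deriv: "\<And>j k t. j \<in> V \<Longrightarrow> t \<in> {0..1} \<Longrightarrow>
      (g j k has_real_derivative g j (Suc k) t) (at t within {0..1})"
  shows "jet V (unit_cube K) (\<lambda>\<alpha> x. \<Prod>j\<in>K. g j (\<alpha> j) (x j))"
  unfolding jet_def
proof (intro allI conjI ballI)
  fix \<alpha>
  show "continuous_on (unit_cube K) (\<lambda>x. \<Prod>j\<in>K. g j (\<alpha> j) (x j))"
    by (rule continuous_on_prod_coordinates[of K "\<lambda>j. g j (\<alpha> j)", OF cont])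
  fix i x assume i: "i \<in> V" and x: "x \<in> unit_cube K"
  have iK: "i \<in> K" using i assms(2) by blast
  have split: "(\<Prod>j\<in>K. h j) = h i * (\<Prod>j\<in>K-{i}. h j)" for h :: "nat \<Rightarrow> real"
    using assms(1) iK by (rule prod.remove)
  have "((\<lambda>t. g i (\<alpha> i) t * (\<Prod>j\<in>K-{i}. g j (\<alpha> j) (x j))) has_real_derivative
      g i (Suc (\<alpha> i)) (x i) * (\<Prod>j\<in>K-{i}. g j (\<alpha> j) (x j))) (at (x i) within {0..1})"
    using x iK by (intro DERIV_cmult_right deriv i) (auto simp: unit_cube_def PiE_iff)
  moreover have "(\<Prod>j\<in>K-{i}. g j (\<alpha> j) ((x(i := t)) j)) = (\<Prod>j\<in>K-{i}. g j (\<alpha> j) (x j))" for t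
    by (rule prod.cong) auto
  moreover have "(\<Prod>j\<in>K-{i}. g j ((\<alpha>(i := Suc (\<alpha> i))) j) (x j)) = (\<Prod>j\<in>K-{i}. g j (\<alpha> j) (x j))"
    by (rule prod.cong) auto
  ultimately show "((\<lambda>t. \<Prod>j\<in>K. g j (\<alpha> j) ((x(i := t)) j)) has_real_derivative
      (\<Prod>j\<in>K. g j ((\<alpha>(i := Suc (\<alpha> i))) j) (x j))) (at (x i) within {0..1})"
    unfolding split by simp
qed

subsection \<open>Integration over cubes\<close>

interpretation lebesgue_cube: product_sigma_finite "\<lambda>_ :: nat. lborel :: real measure" ..

section \<open>Borel structure of the cubes and integrability of bounded continuous
  functions\<close>

lemma open_cube_subset_unit_cube: "open_cube K \<subseteq> unit_cube K"
  unfolding open_cube_def unit_cube_def by (intro PiE_mono) auto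

text \<open>Extensionality is itself a condition on coordinates, namely the value
  \<open>undefined\<close> outside \<open>K\<close>, so the set is a countable intersection of Borel
  cylinders in the full product topology.\<close>

lemma borel_PiE:
  fixes S :: "real set" and K :: "nat set"
  assumes "S \<in> sets borel"
  shows "PiE K (\<lambda>_. S) \<in> sets (borel :: (nat \<Rightarrow> real) measure)"
proof -
  have "PiE K (\<lambda>_. S) = (\<Inter>i. (\<lambda>x. x i) -` (if i \<in> K then S else {undefined}))"
    by (auto simp: PiE_iff extensional_def split: if_splits)
  moreover have "(\<lambda>x :: nat \<Rightarrow> real. x i) -` T \<in> sets borel" if "T \<in> sets borel" for i T
    using measurable_sets[OF borel_measurable_continuous_onI[OF continuous_on_product_coordinates] that]
    by simp
  ultimately show ?thesis
    using assms by (auto intro!: sets.countable_INT'')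
qed

text \<open>Continuity refers to the topology on all functions, integration to the product over
  \<open>K\<close>. The identity links the two: on the underlying space the coordinates outside
  \<open>K\<close> are constant, hence measurable.\<close>

lemma measurable_ident_PiM:
  fixes K :: "nat set"
  shows "(\<lambda>x. x) \<in> measurable (lebesgue_PiM K) (borel :: (nat \<Rightarrow> real) measure)"
proof -
  have "(\<lambda>x. x) \<in> measurable (lebesgue_PiM K) (PiM UNIV (\<lambda>_. borel :: real measure))"
  proof (rule measurable_PiM_single')
    show "(\<lambda>x. x i) \<in> measurable (lebesgue_PiM K) borel" for i
    proof (cases "i \<in> K")
      case True
      then show ?thesis by measurable
    next
      case False
      then have "(\<lambda>x. x i) \<in> measurable (lebesgue_PiM K) borel \<longleftrightarrow>
          (\<lambda>x. undefined :: real) \<in> measurable (lebesgue_PiM K) borel"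
        by (intro measurable_cong) (auto simp: space_PiM PiE_iff extensional_def)
      then show ?thesis by simp
    qed
  qed simp
  then show ?thesis
    by (simp add: measurable_def sets_PiM_equal_borel space_PiM)
qed

text \<open>A bounded measurable function on a set of finite volume is integrable. The bound is a
  hypothesis because the open cube, which is to be covered too, is not compact.\<close>

lemma set_integrable_cube:
  fixes f :: "(nat \<Rightarrow> real) \<Rightarrow> real"
  assumes "finite K" and A: "A = PiE K (\<lambda>_. S)" "S \<subseteq> {0..1}" "S \<in> sets borel"
    and f: "continuous_on A f" and B: "\<And>x. x \<in> A \<Longrightarrow> \<bar>f x\<bar> \<le> B"
  shows "set_integrable (lebesgue_PiM K) A f"
proof -
  have A_sets: "A \<in> sets (lebesgue_PiM K)"
    unfolding A using assms by (intro sets_PiM_I_finite) auto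
  have "emeasure (lebesgue_PiM K) A = (\<Prod>i\<in>K. emeasure lborel S)"
    unfolding A(1) using assms by (intro lebesgue_cube.emeasure_PiM) auto
  moreover have "emeasure lborel S < \<infinity>"
    using emeasure_mono[OF A(2), of lborel] by (auto simp: less_top[symmetric] top_unique)
  ultimately have fin: "emeasure (lebesgue_PiM K) A < \<infinity>"
    by (simp add: ennreal_prod_eq_top power_eq_top_ennreal less_top[symmetric])
  have "(\<lambda>x. indicator A x *\<^sub>R f x) \<in> borel_measurable borel"
    using f borel_PiE[OF A(3)] A by (intro borel_measurable_continuous_on_indicator) auto
  from measurable_compose[OF measurable_ident_PiM this]
  have meas: "(\<lambda>x. indicator A x *\<^sub>R f x) \<in> borel_measurable (lebesgue_PiM K)"
    by simp
  show ?thesis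
    unfolding set_integrable_def
  proof (rule Bochner_Integration.integrable_bound[OF _ meas])
    show "integrable (lebesgue_PiM K) (\<lambda>x. indicator A x *\<^sub>R B)"
      using A_sets fin by (simp add: integrable_indicator_iff)
    show "AE x in lebesgue_PiM K. norm (indicator A x *\<^sub>R f x) \<le> norm (indicator A x *\<^sub>R B)"
      using B by (auto simp: indicator_def intro!: AE_I2 order_trans[OF B abs_ge_self])
  qed
qed

lemma set_integrable_open_cube:
  fixes f :: "(nat \<Rightarrow> real) \<Rightarrow> real"
  assumes "finite K" "continuous_on (open_cube K) f" "\<And>x. x \<in> open_cube K \<Longrightarrow> \<bar>f x\<bar> \<le> B"
  shows "set_integrable (lebesgue_PiM K) (open_cube K) f"
  using assms by (intro set_integrable_cube[where S = "{0<..<1}"]) (auto simp: open_cube_def)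

lemma set_integrable_unit_cube:
  fixes f :: "(nat \<Rightarrow> real) \<Rightarrow> real"
  assumes "finite K" "continuous_on (unit_cube K) f" "\<And>x. x \<in> unit_cube K \<Longrightarrow> \<bar>f x\<bar> \<le> B"
  shows "set_integrable (lebesgue_PiM K) (unit_cube K) f"
  using assms by (intro set_integrable_cube[where S = "{0..1}"]) (auto simp: unit_cube_def)

section \<open>Fubini for one additional coordinate\<close>

lemma open_cube_insert_iff:
  assumes "b \<notin> K" "x \<in> extensional K"
  shows "x(b := t) \<in> open_cube (insert b K) \<longleftrightarrow> x \<in> open_cube K \<and> t \<in> {0<..<1}"
  using assms by (auto simp: open_cube_def PiE_iff extensional_def)

lemma open_cube_upd:
  assumes "x \<in> open_cube K" "t \<in> {0<..<1}"
  shows "x(b := t) \<in> open_cube (insert b K)"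
  using assms unfolding open_cube_def by (intro PiE_fun_upd)

lemma LINT_open_cube_insert:
  assumes "finite K" "b \<notin> K"
    and "set_integrable (lebesgue_PiM (insert b K)) (open_cube (insert b K)) f"
  shows "(LINT x:open_cube (insert b K)|lebesgue_PiM (insert b K). f x :: real)
    = (LINT x:open_cube K|lebesgue_PiM K. LINT t:{0<..<1}|lborel. f (x(b := t)))"
proof -
  have "(LINT x:open_cube (insert b K)|lebesgue_PiM (insert b K). f x)
      = (LINT x|lebesgue_PiM K. LINT t|lborel.
          indicator (open_cube (insert b K)) (x(b := t)) *\<^sub>R f (x(b := t)))"
    using assms unfolding set_integrable_def set_lebesgue_integral_def
    by (rule lebesgue_cube.product_integral_insert)
  also have "\<dots> = (LINT x|lebesgue_PiM K. LINT t|lborel.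
      indicator (open_cube K) x *\<^sub>R (indicator {0<..<1} t *\<^sub>R f (x(b := t))))"
  proof (intro Bochner_Integration.integral_cong refl)
    fix x t assume "x \<in> space (lebesgue_PiM K)"
    then have "x \<in> extensional K" by (simp add: space_PiM PiE_iff)
    with open_cube_insert_iff[OF assms(2) this, of t]
    show "indicator (open_cube (insert b K)) (x(b := t)) *\<^sub>R f (x(b := t))
      = indicator (open_cube K) x *\<^sub>R (indicator {0<..<1} t *\<^sub>R f (x(b := t)))"
      by (auto simp: indicator_def)
  qed
  also have "\<dots> = (LINT x:open_cube K|lebesgue_PiM K. LINT t:{0<..<1}|lborel. f (x(b := t)))"
    by (simp add: set_lebesgue_integral_def)
  finally show ?thesis .
qed

subsection \<open>Test functions\<close>

lemma slice_open_open_cube: "slice_open K (open_cube K)"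
  unfolding slice_open_def
proof (intro ballI conjI)
  fix x j assume x: "x \<in> open_cube K" and j: "j \<in> K"
  then have xj: "0 < x j" "x j < 1" by (auto simp: open_cube_def dest: PiE_mem)
  then show "x j \<in> {0..1}" by simp
  have "\<forall>\<^sub>F t in nhds (x j). t \<in> {0<..<1}"
    using xj by (intro eventually_nhds_in_open) auto
  then show "\<forall>\<^sub>F t in nhds (x j). t \<in> {0..1} \<longrightarrow> x(j := t) \<in> open_cube K"
    using open_cube_upd[OF x, of _ j] j by (auto elim!: eventually_mono simp: insert_absorb)
qed

lemma test_fun_continuous: "test_fun K \<phi> \<Longrightarrow> continuous_on (open_cube K) \<phi>"
  using C_class.simps(1) unfolding test_fun_def by blast

lemma test_fun_bounded:
  assumes "test_fun K \<phi>"
  obtains B where "\<And>x. x \<in> open_cube K \<Longrightarrow> \<bar>\<phi> x\<bar> \<le> B"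
proof -
  obtain C where C: "compact C" "C \<subseteq> open_cube K" "\<forall>x\<in>open_cube K - C. \<phi> x = 0"
    using assms unfolding test_fun_def by blast
  have "compact (\<phi> ` C)"
    using C continuous_on_subset[OF test_fun_continuous[OF assms]]
    by (intro compact_continuous_image) auto
  then obtain B where B: "\<forall>x\<in>C. \<bar>\<phi> x\<bar> \<le> B"
    by (auto dest!: compact_imp_bounded simp: bounded_iff)
  \<comment> \<open>Off \<open>C\<close> the function vanishes, and \<open>B\<close> could be
    negative if \<open>C\<close> is empty; hence the maximum with 0.\<close>
  have "\<bar>\<phi> x\<bar> \<le> max B 0" if "x \<in> open_cube K" for x
    using B C(3) that by (cases "x \<in> C") (auto simp: le_max_iff_disj)
  then show thesis by (rule that)
qed

text \<open>The complement of \<open>C\<close> is open, so the function vanishes near the point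
  along the coordinate line. Thus the same compact set \<open>C\<close> serves as support for all
  derivatives.\<close>

lemma partial_deriv_eq_0:
  assumes "compact C" "\<forall>x\<in>open_cube K - C. \<phi> x = 0" "j \<in> K" "x \<in> open_cube K - C"
  shows "partial_deriv j \<phi> x = 0"
proof -
  have "slice_open K {x \<in> open_cube K. x \<in> - C}"
    using compact_imp_closed[OF assms(1)]
    by (intro slice_open_inter_continuous slice_open_open_cube) (auto intro: continuous_on_id)
  then have so: "slice_open K (open_cube K - C)"
    by (simp add: set_diff_eq)
  have "partial_deriv j \<phi> x = partial_deriv j (\<lambda>_. 0) x"
    using assms by (intro partial_deriv_cong[OF so]) auto
  also have "\<dots> = 0"
    unfolding partial_deriv_def using slice_openD(1)[OF so assms(4,3)]
    by (intro vector_derivative_within_closed_interval has_vector_derivative_const) auto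
  finally show ?thesis .
qed

lemma test_fun_partial_deriv:
  assumes "test_fun K \<phi>" "j \<in> K"
  shows "test_fun K (partial_deriv j \<phi>)"
proof -
  obtain C where C: "compact C" "C \<subseteq> open_cube K" "\<forall>x\<in>open_cube K - C. \<phi> x = 0"
    using assms unfolding test_fun_def by blast
  have "C_class r K (open_cube K) (partial_deriv j \<phi>)" for r
    using assms unfolding test_fun_def by (metis C_class.simps(2))
  with C partial_deriv_eq_0[OF C(1,3) assms(2)] show ?thesis
    unfolding test_fun_def by blast
qed

section \<open>Slices of test functions with one coordinate frozen\<close>

lemma partial_deriv_upd:
  assumes "i \<noteq> b"
  shows "partial_deriv i (\<lambda>x. \<phi> (x(b := c))) = (\<lambda>x. partial_deriv i \<phi> (x(b := c)))"
  using assms by (simp add: partial_deriv_def fun_upd_twist fun_eq_iff)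

lemma C_class_upd:
  assumes "C_class r W A \<phi>" "\<And>x. x \<in> A' \<Longrightarrow> x(b := c) \<in> A" "b \<notin> V" "V \<subseteq> W"
  shows "C_class r V A' (\<lambda>x. \<phi> (x(b := c)))"
  using assms(1)
proof (induction r arbitrary: \<phi>)
  have upd: "continuous_on A' (\<lambda>x. x(b := c))"
  proof (rule continuous_on_coordinatewise_then_product)
    show "continuous_on A' (\<lambda>x. (x(b := c)) i)" for i
      by (cases "i = b") (auto intro: continuous_on_subset[OF continuous_on_product_coordinates])
  qed
  have cont: "continuous_on A' (\<lambda>x. \<phi> (x(b := c)))" if "continuous_on A \<phi>" for \<phi>
  proof (rule continuous_on_compose2[OF that upd])
    show "(\<lambda>x. x(b := c)) ` A' \<subseteq> A" using assms(2) by blast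
  qed
  { case 0
    then show ?case using cont[of \<phi>] by (simp del: fun_upd_apply)
  next
    case (Suc r)
    have "(\<lambda>t. \<phi> ((x(j := t))(b := c))) differentiable (at (x j) within {0..1})"
      if x: "x \<in> A'" and j: "j \<in> V" for x j
    proof -
      have jb: "j \<noteq> b" using j assms(3) by blast
      have "(\<lambda>t. \<phi> ((x(b := c))(j := t))) differentiable (at ((x(b := c)) j) within {0..1})"
        using Suc.prems assms(2)[OF x] j assms(4) unfolding C_class.simps by blast
      then show ?thesis unfolding fun_upd_other[OF jb] fun_upd_twist[OF jb] .
    qed
    moreover have "C_class r V A' (partial_deriv j (\<lambda>x. \<phi> (x(b := c))))" if j: "j \<in> V" for j
    proof -
      have "j \<noteq> b" using j assms(3) by blast
      moreover have "C_class r W A (partial_deriv j \<phi>)"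
        using Suc.prems j assms(4) by auto
      ultimately show ?thesis
        unfolding partial_deriv_upd[OF \<open>j \<noteq> b\<close>] by (intro Suc.IH)
    qed
    moreover have "continuous_on A' (\<lambda>x. \<phi> (x(b := c)))"
      using Suc.prems by (intro cont) simp
    ultimately show ?case unfolding C_class.simps by blast
  }
qed

text \<open>The slice is supported in the projection of \<open>C\<close> that erases coordinate
  \<open>b\<close>, a continuous image and hence compact. Erasing means writing
  \<open>undefined\<close>, which makes the image extensional on \<open>K\<close>.\<close>

lemma test_fun_upd:
  assumes \<phi>: "test_fun (insert b K) \<phi>" and "b \<notin> K" "t \<in> {0<..<1}"
  shows "test_fun K (\<lambda>x. \<phi> (x(b := t)))"
proof -
  obtain C where C: "compact C" "C \<subseteq> open_cube (insert b K)"
    "\<forall>x\<in>open_cube (insert b K) - C. \<phi> x = 0"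
    using \<phi> unfolding test_fun_def by blast
  have "C_class r K (open_cube K) (\<lambda>x. \<phi> (x(b := t)))" for r
    using \<phi> assms(2,3) unfolding test_fun_def
    by (intro C_class_upd[where W = "insert b K" and A = "open_cube (insert b K)"] open_cube_upd) auto
  moreover have "compact ((\<lambda>y. y(b := undefined)) ` C)"
  proof (intro compact_continuous_image C(1) continuous_on_coordinatewise_then_product)
    show "continuous_on C (\<lambda>y. (y(b := undefined)) i)" for i
      by (cases "i = b") (auto intro: continuous_on_subset[OF continuous_on_product_coordinates])
  qed
  moreover have "(\<lambda>y. y(b := undefined)) ` C \<subseteq> open_cube K"
    using C(2) assms(2) by (auto simp: open_cube_def PiE_iff extensional_def)
  moreover have "\<phi> (x(b := t)) = 0" if x: "x \<in> open_cube K - (\<lambda>y. y(b := undefined)) ` C" for x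
  proof -
    have "x(b := t, b := undefined) = x"
      using x assms(2) by (auto simp: open_cube_def PiE_iff extensional_def fun_eq_iff)
    then have "x(b := t) \<notin> C" using x by (metis DiffD2 image_eqI)
    then show ?thesis using C(3) open_cube_upd[of x K t b] x assms(3) by blast
  qed
  ultimately show ?thesis unfolding test_fun_def by blast
qed

lemma test_fun_has_derivative:
  assumes "test_fun (insert b K) \<phi>" "x \<in> open_cube K" "t \<in> {0<..<1}"
  shows "((\<lambda>s. \<phi> (x(b := s))) has_real_derivative partial_deriv b \<phi> (x(b := t))) (at t)"
proof -
  have "C_class (Suc 0) (insert b K) (open_cube (insert b K)) \<phi>"
    using assms(1) unfolding test_fun_def by blast
  then have "(\<lambda>s. \<phi> ((x(b := t))(b := s))) differentiable (at ((x(b := t)) b) within {0..1})"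
    using open_cube_upd[OF assms(2,3), of b] by auto
  then have "((\<lambda>s. \<phi> (x(b := s))) has_vector_derivative partial_deriv b \<phi> (x(b := t)))
      (at t within {0..1})"
    by (simp add: vector_derivative_works partial_deriv_def)
  then show ?thesis
    using assms(3) by (simp add: has_real_derivative_iff_has_vector_derivative at_within_Icc_at)
qed

subsection \<open>One-dimensional kernels\<close>

text \<open>\<open>g'' = c \<delta>\<^sub>p\<close> in the sense of distributions on \<open>(0, 1)\<close>.\<close>

definition second_kernel :: "(real \<Rightarrow> real) \<Rightarrow> real \<Rightarrow> real \<Rightarrow> bool" where
  "second_kernel g c p \<longleftrightarrow> continuous_on {0..1} g \<and> 0 < p \<and> p < 1 \<and>
     (\<forall>h h1 h2 \<alpha> \<beta>. 0 < \<alpha> \<longrightarrow> \<beta> < 1 \<longrightarrow> continuous_on {0<..<1} h2 \<longrightarrow>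
       (\<forall>t\<in>{0<..<1}. (h has_real_derivative h1 t) (at t)) \<longrightarrow>
       (\<forall>t\<in>{0<..<1}. (h1 has_real_derivative h2 t) (at t)) \<longrightarrow>
       (\<forall>t\<in>{0<..<1} - {\<alpha>..\<beta>}. h t = 0 \<and> h1 t = 0 \<and> h2 t = 0) \<longrightarrow>
       (LINT t:{0<..<1}|lborel. g t * h2 t) = c * h p)"

text \<open>Passes from the Lebesgue integral over the open interval to a gauge integral over a
  compact one, where the fundamental theorem of calculus applies and the boundary terms
  vanish.\<close>

lemma second_kernelI:
  assumes g: "continuous_on {0..1} g" and p: "0 < p" "p < 1"
    and int: "\<And>h h1 h2 a b. \<lbrakk>0 < a; a < p; p < b; b < 1;
       \<And>t. t \<in> {a..b} \<Longrightarrow> (h has_real_derivative h1 t) (at t);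
       \<And>t. t \<in> {a..b} \<Longrightarrow> (h1 has_real_derivative h2 t) (at t);
       h a = 0; h1 a = 0; h b = 0; h1 b = 0\<rbrakk>
       \<Longrightarrow> ((\<lambda>t. g t * h2 t) has_integral c * h p) {a..b}"
  shows "second_kernel g c p"
  unfolding second_kernel_def
proof (intro conjI allI impI g p)
  fix h h1 h2 :: "real \<Rightarrow> real" and \<alpha> \<beta> :: real
  assume h: "0 < \<alpha>" "\<beta> < 1" "continuous_on {0<..<1} h2"
    "\<forall>t\<in>{0<..<1}. (h has_real_derivative h1 t) (at t)"
    "\<forall>t\<in>{0<..<1}. (h1 has_real_derivative h2 t) (at t)"
    and supp: "\<forall>t\<in>{0<..<1} - {\<alpha>..\<beta>}. h t = 0 \<and> h1 t = 0 \<and> h2 t = 0"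
  \<comment> \<open>The midpoints between 0 and the smaller of \<open>\<alpha>\<close> and
    \<open>p\<close>, and between the larger of \<open>\<beta>\<close> and \<open>p\<close> and 1:
    both lie in the open unit interval, off the support, with \<open>p\<close> between them.\<close>
  define a b where "a = min \<alpha> p / 2" and "b = (max \<beta> p + 1) / 2"
  have ab: "0 < a" "a < p" "p < b" "b < 1" "a < \<alpha>" "\<beta> < b"
    using h(1,2) p unfolding a_def b_def by (auto simp: min_def max_def)
  have sub: "{a..b} \<subseteq> {0<..<1}" using ab by auto
  have "((\<lambda>t. g t * h2 t) has_integral c * h p) {a..b}"
    using ab supp sub by (intro int[of a b h h1 h2] h(4,5)[rule_format]) auto
  moreover have "set_integrable lborel {a..b} (\<lambda>t. g t * h2 t)"
    using ab sub
    by (intro borel_integrable_atLeastAtMost' continuous_on_mult continuous_on_subset[OF h(3)]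
        continuous_on_subset[OF g]) auto
  ultimately have "(LINT t:{a..b}|lborel. g t * h2 t) = c * h p"
    by (simp add: set_borel_integral_eq_integral(2) integral_unique)
  moreover have "(LINT t:{0<..<1}|lborel. g t * h2 t) = (LINT t:{a..b}|lborel. g t * h2 t)"
    unfolding set_lebesgue_integral_def
    using ab supp by (intro Bochner_Integration.integral_cong) (auto simp: indicator_def)
  ultimately show "(LINT t:{0<..<1}|lborel. g t * h2 t) = c * h p" by simp
qed

lemma second_kernelD:
  assumes "second_kernel g c p" "0 < \<alpha>" "\<beta> < 1" "continuous_on {0<..<1} h2"
    "\<forall>t\<in>{0<..<1}. (h has_real_derivative h1 t) (at t)"
    "\<forall>t\<in>{0<..<1}. (h1 has_real_derivative h2 t) (at t)"
    "\<forall>t\<in>{0<..<1} - {\<alpha>..\<beta>}. h t = 0 \<and> h1 t = 0 \<and> h2 t = 0"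
  shows "(LINT t:{0<..<1}|lborel. g t * h2 t) = c * h p"
  using assms unfolding second_kernel_def by blast

lemma second_kernel_linear:
  assumes "0 < p" "p < 1"
  shows "second_kernel (\<lambda>t. t * r) 0 p"
proof (rule second_kernelI[OF _ assms])
  fix h h1 h2 :: "real \<Rightarrow> real" and a b
  assume h: "a < p" "p < b"
    "\<And>t. t \<in> {a..b} \<Longrightarrow> (h has_real_derivative h1 t) (at t)"
    "\<And>t. t \<in> {a..b} \<Longrightarrow> (h1 has_real_derivative h2 t) (at t)"
    and zero: "h a = 0" "h1 a = 0" "h b = 0" "h1 b = 0"
  \<comment> \<open>The primitive from two integrations by parts: the derivative of t h' - h is t
    h''. It vanishes where h and h' do.\<close>
  define P where "P = (\<lambda>t. r * (t * h1 t - h t))"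
  have "(P has_real_derivative t * r * h2 t) (at t)" if "t \<in> {a..b}" for t
    unfolding P_def using h(3,4)[OF that]
    by (auto intro!: derivative_eq_intros simp: algebra_simps)
  then have "((\<lambda>t. t * r * h2 t) has_integral P b - P a) {a..b}"
    using h(1,2) by (intro fundamental_theorem_of_calculus)
      (auto simp: has_real_derivative_iff_has_vector_derivative[symmetric]
        intro: has_field_derivative_at_within)
  then show "((\<lambda>t. t * r * h2 t) has_integral 0 * h p) {a..b}"
    by (simp add: P_def zero)
qed (intro continuous_intros)

lemma second_kernel_min:
  assumes "0 < p" "p < 1"
  shows "second_kernel (\<lambda>t. min t p) (-1) p"
proof (rule second_kernelI[OF _ assms])
  fix h h1 h2 :: "real \<Rightarrow> real" and a b
  assume h: "a < p" "p < b"
    "\<And>t. t \<in> {a..b} \<Longrightarrow> (h has_real_derivative h1 t) (at t)"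
    "\<And>t. t \<in> {a..b} \<Longrightarrow> (h1 has_real_derivative h2 t) (at t)"
    and zero: "h a = 0" "h1 a = 0" "h b = 0" "h1 b = 0"
  \<comment> \<open>The primitive is t h' - h left of \<open>p\<close> and p h' - h(p) right of it;
    the branches agree at \<open>p\<close>. Taking \<open>p\<close> as an exceptional point, the
    fundamental theorem yields -h(p), contributed by the right end.\<close>
  define P where "P = (\<lambda>t. min t p * h1 t - h (min t p))"
  have cont: "continuous_on {a..b} h" "continuous_on {a..b} h1"
    using h(3,4) by (auto intro!: DERIV_atLeastAtMost_imp_continuous_on)
  have "continuous_on {a..b} P"
    unfolding P_def using h(1,2)
    by (intro continuous_intros cont continuous_on_compose2[OF cont(1)]) auto
  moreover have "(P has_real_derivative min t p * h2 t) (at t)" if t: "t \<in> {a..b} - {p}" for t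
  proof (cases "t < p")
    case True
    have "((\<lambda>t. t * h1 t - h t) has_real_derivative min t p * h2 t) (at t)"
      using h(3,4)[of t] t True by (auto intro!: derivative_eq_intros)
    moreover have "\<forall>\<^sub>F s in nhds t. P s = s * h1 s - h s"
      using eventually_nhds_in_open[of "{..<p}" t] True
      by (auto elim!: eventually_mono simp: P_def)
    ultimately show ?thesis by (simp add: DERIV_cong_ev[OF refl _ refl])
  next
    case False
    have "((\<lambda>t. p * h1 t - h p) has_real_derivative min t p * h2 t) (at t)"
      using h(4)[of t] t False by (auto intro!: derivative_eq_intros)
    moreover have "\<forall>\<^sub>F s in nhds t. P s = p * h1 s - h p"
      using eventually_nhds_in_open[of "{p<..}" t] False t
      by (auto elim!: eventually_mono simp: P_def)
    ultimately show ?thesis by (simp add: DERIV_cong_ev[OF refl _ refl])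
  qed
  ultimately have "((\<lambda>t. min t p * h2 t) has_integral P b - P a) {a..b}"
    using h(1,2) by (intro fundamental_theorem_of_calculus_strong[of "{p}"])
      (auto simp: has_real_derivative_iff_has_vector_derivative)
  then show "((\<lambda>t. min t p * h2 t) has_integral - 1 * h p) {a..b}"
    using h(1,2) by (simp add: P_def zero)
qed (intro continuous_intros)

subsection \<open>Iterated distributional derivatives of product functions\<close>

text \<open>On the line through \<open>x\<close> in direction \<open>b\<close> the test function has
  compact support in the open interval, found by projecting \<open>C\<close> to that coordinate; so
  the one-dimensional kernel property applies.\<close>

lemma test_fun_kernel:
  assumes \<phi>: "test_fun (insert b K) \<phi>" and b: "b \<notin> K" and g: "second_kernel g c p"
    and x: "x \<in> open_cube K"
  shows "(LINT t:{0<..<1}|lborel. g t * partial_deriv b (partial_deriv b \<phi>) (x(b := t)))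
    = c * \<phi> (x(b := p))"
proof -
  obtain C where C: "compact C" "C \<subseteq> open_cube (insert b K)"
    "\<forall>y\<in>open_cube (insert b K) - C. \<phi> y = 0"
    using \<phi> unfolding test_fun_def by blast
  have T: "test_fun (insert b K) (partial_deriv b \<phi>)"
    "test_fun (insert b K) (partial_deriv b (partial_deriv b \<phi>))"
    using \<phi> by (auto intro!: test_fun_partial_deriv)
  have Z: "\<forall>y\<in>open_cube (insert b K) - C. partial_deriv b \<phi> y = 0"
    "\<forall>y\<in>open_cube (insert b K) - C. partial_deriv b (partial_deriv b \<phi>) y = 0"
    using partial_deriv_eq_0[OF C(1,3)] partial_deriv_eq_0[OF C(1), of "insert b K" "partial_deriv b \<phi>"]
    by auto
  have "compact ((\<lambda>y. y b) ` C)"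
    by (intro compact_continuous_image C(1) continuous_on_subset[OF continuous_on_product_coordinates]) auto
  moreover have sub: "(\<lambda>y. y b) ` C \<subseteq> {0<..<1}"
    using C(2) by (auto simp: open_cube_def dest!: PiE_mem[of _ _ _ b] subsetD)
  ultimately obtain \<alpha> \<beta> :: real where ab: "0 < \<alpha>" "\<beta> < 1" "(\<lambda>y. y b) ` C \<subseteq> {\<alpha>..\<beta>}"
  proof (cases "C = {}")
    case True
    \<comment> \<open>An empty \<open>C\<close> is covered by the empty interval from 1 to 0, whose
      ends satisfy both strict bounds.\<close>
    then show ?thesis using that[of 1 0] by simp
  next
    case False
    then have ne: "(\<lambda>y. y b) ` C \<noteq> {}" by simp
    obtain u where u: "u \<in> (\<lambda>y. y b) ` C" "\<forall>t\<in>(\<lambda>y. y b) ` C. u \<le> t"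
      using compact_attains_inf[OF \<open>compact ((\<lambda>y. y b) ` C)\<close> ne] by blast
    obtain v where v: "v \<in> (\<lambda>y. y b) ` C" "\<forall>t\<in>(\<lambda>y. y b) ` C. t \<le> v"
      using compact_attains_sup[OF \<open>compact ((\<lambda>y. y b) ` C)\<close> ne] by blast
    show ?thesis
      using sub u v by (intro that[of u v]) (auto simp: subset_iff)
  qed
  have out: "x(b := t) \<in> open_cube (insert b K) - C" if "t \<in> {0<..<1} - {\<alpha>..\<beta>}" for t
  proof -
    have "x(b := t) \<notin> C"
    proof
      assume "x(b := t) \<in> C"
      then have "(x(b := t)) b \<in> {\<alpha>..\<beta>}" using ab(3) by blast
      with that show False by simp
    qed
    with open_cube_upd[OF x, of t b] that show ?thesis by simp
  qed
  have upd: "continuous_on {0<..<1} (\<lambda>t. x(b := t))"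
  proof (rule continuous_on_coordinatewise_then_product)
    show "continuous_on {0<..<1} (\<lambda>t. (x(b := t)) i)" for i
      by (cases "i = b") (auto intro: continuous_on_id)
  qed
  have "continuous_on {0<..<1} (\<lambda>t. partial_deriv b (partial_deriv b \<phi>) (x(b := t)))"
  proof (rule continuous_on_compose2[OF test_fun_continuous[OF T(2)] upd])
    show "(\<lambda>t. x(b := t)) ` {0<..<1} \<subseteq> open_cube (insert b K)"
      using open_cube_upd[OF x] by blast
  qed
  moreover have "\<forall>t\<in>{0<..<1}. ((\<lambda>s. \<phi> (x(b := s))) has_real_derivative
      partial_deriv b \<phi> (x(b := t))) (at t)"
    using test_fun_has_derivative[OF \<phi> x] by blast
  moreover have "\<forall>t\<in>{0<..<1}. ((\<lambda>s. partial_deriv b \<phi> (x(b := s))) has_real_derivative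
      partial_deriv b (partial_deriv b \<phi>) (x(b := t))) (at t)"
    using test_fun_has_derivative[OF T(1) x] by blast
  moreover have "\<forall>t\<in>{0<..<1} - {\<alpha>..\<beta>}. \<phi> (x(b := t)) = 0 \<and> partial_deriv b \<phi> (x(b := t)) = 0 \<and>
      partial_deriv b (partial_deriv b \<phi>) (x(b := t)) = 0"
    using out C(3) Z by blast
  ultimately show ?thesis
    by (rule second_kernelD[OF g ab(1,2)])
qed

section \<open>Pairing products of one-variable functions with test functions\<close>

lemma set_integrable_mult_test_fun:
  assumes "finite K" "continuous_on (unit_cube K) f" "\<And>x. x \<in> unit_cube K \<Longrightarrow> \<bar>f x\<bar> \<le> B"
    "test_fun K \<phi>"
  shows "set_integrable (lebesgue_PiM K) (open_cube K) (\<lambda>x. f x * \<phi> x)"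
proof -
  obtain B' where B': "\<And>x. x \<in> open_cube K \<Longrightarrow> \<bar>\<phi> x\<bar> \<le> B'"
    using test_fun_bounded[OF assms(4)] by blast
  show ?thesis
  proof (rule set_integrable_open_cube[OF assms(1)])
    show "continuous_on (open_cube K) (\<lambda>x. f x * \<phi> x)"
      by (intro continuous_on_mult continuous_on_subset[OF assms(2)] open_cube_subset_unit_cube
          test_fun_continuous assms(4))
    show "\<bar>f x * \<phi> x\<bar> \<le> \<bar>B\<bar> * \<bar>B'\<bar>" if "x \<in> open_cube K" for x
      unfolding abs_mult
      using B'[OF that] assms(3)[of x] that open_cube_subset_unit_cube[of K]
      by (intro mult_mono) auto
  qed
qed

lemma prod_coordinates_bounded:
  assumes "\<And>j. j \<in> K \<Longrightarrow> continuous_on {0..1} (g j :: real \<Rightarrow> real)"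
  obtains B where "\<And>x. x \<in> unit_cube K \<Longrightarrow> \<bar>\<Prod>j\<in>K. g j (x j)\<bar> \<le> B"
proof -
  have "\<exists>B. \<forall>t\<in>{0..1}. \<bar>g j t\<bar> \<le> B" if "j \<in> K" for j
    using compact_imp_bounded[OF compact_continuous_image[OF assms[OF that] compact_Icc]]
    by (auto simp: bounded_iff)
  then obtain B where B: "\<And>j t. j \<in> K \<Longrightarrow> t \<in> {0..1} \<Longrightarrow> \<bar>g j t\<bar> \<le> B j" by metis
  have "\<bar>\<Prod>j\<in>K. g j (x j)\<bar> \<le> (\<Prod>j\<in>K. B j)" if "x \<in> unit_cube K" for x
    unfolding abs_prod using that B
    by (intro prod_mono) (auto simp: unit_cube_def PiE_iff)
  then show thesis by (rule that)
qed

lemma set_integrable_prod_mult_test_fun: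
  assumes "finite K" "\<And>j. j \<in> K \<Longrightarrow> continuous_on {0..1} (g j :: real \<Rightarrow> real)" "test_fun K \<phi>"
  shows "set_integrable (lebesgue_PiM K) (open_cube K) (\<lambda>x. (\<Prod>j\<in>K. g j (x j)) * \<phi> x)"
proof -
  obtain B where "\<And>x. x \<in> unit_cube K \<Longrightarrow> \<bar>\<Prod>j\<in>K. g j (x j)\<bar> \<le> B"
    using prod_coordinates_bounded[of K g] assms(2) by blast
  then show ?thesis
    using assms by (intro set_integrable_mult_test_fun continuous_on_prod_coordinates)
qed

lemma sets_open_cube: "finite K \<Longrightarrow> open_cube K \<in> sets (lebesgue_PiM K)"
  unfolding open_cube_def by (intro sets_PiM_I_finite) auto

text \<open>By Fubini the inner integral concerns coordinate \<open>b\<close> alone, where the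
  kernel evaluates the test function at \<open>p b\<close>. What remains is the same pairing over
  \<open>K\<close> with a frozen test function.\<close>

lemma regular_distr_insert:
  assumes fin: "finite K" and b: "b \<notin> K" and \<phi>: "test_fun (insert b K) \<phi>"
    and g: "\<And>j. j \<in> insert b K \<Longrightarrow> second_kernel (g j) (c j) (p j)"
  shows "regular_distr (insert b K) (\<lambda>x. \<Prod>j\<in>insert b K. g j (x j)) (partial_deriv b (partial_deriv b \<phi>))
    = c b * regular_distr K (\<lambda>x. \<Prod>j\<in>K. g j (x j)) (\<lambda>x. \<phi> (x(b := p b)))"
proof -
  let ?\<psi> = "partial_deriv b (partial_deriv b \<phi>)"
  have \<psi>: "test_fun (insert b K) ?\<psi>"
    using \<phi> by (auto intro!: test_fun_partial_deriv)
  have prod: "(\<Prod>j\<in>K. g j ((x(b := t)) j)) = (\<Prod>j\<in>K. g j (x j))" for x t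
    using b by (intro prod.cong) auto
  have "regular_distr (insert b K) (\<lambda>x. \<Prod>j\<in>insert b K. g j (x j)) ?\<psi>
     = (LINT x:open_cube K|lebesgue_PiM K. LINT t:{0<..<1}|lborel.
         (\<Prod>j\<in>insert b K. g j ((x(b := t)) j)) * ?\<psi> (x(b := t)))"
    unfolding regular_distr_def
    using assms by (intro LINT_open_cube_insert set_integrable_prod_mult_test_fun \<psi>)
      (auto simp: second_kernel_def)
  also have "\<dots> = (LINT x:open_cube K|lebesgue_PiM K.
      c b * ((\<Prod>j\<in>K. g j (x j)) * \<phi> (x(b := p b))))"
  proof (intro set_lebesgue_integral_cong sets_open_cube fin allI impI)
    fix x assume x: "x \<in> open_cube K"
    have "(\<Prod>j\<in>insert b K. g j ((x(b := t)) j)) * ?\<psi> (x(b := t))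
        = (\<Prod>j\<in>K. g j (x j)) * (g b t * ?\<psi> (x(b := t)))" for t
      using fin b by (simp add: prod fun_upd_same mult.assoc mult.left_commute del: fun_upd_apply)
    then have "(LINT t:{0<..<1}|lborel. (\<Prod>j\<in>insert b K. g j ((x(b := t)) j)) * ?\<psi> (x(b := t)))
        = (LINT t:{0<..<1}|lborel. (\<Prod>j\<in>K. g j (x j)) * (g b t * ?\<psi> (x(b := t))))"
      by (simp only:)
    also have "\<dots> = (\<Prod>j\<in>K. g j (x j)) * (c b * \<phi> (x(b := p b)))"
      using test_fun_kernel[OF \<phi> b g x] by simp
    finally show "(LINT t:{0<..<1}|lborel. (\<Prod>j\<in>insert b K. g j ((x(b := t)) j)) * ?\<psi> (x(b := t)))
        = c b * ((\<Prod>j\<in>K. g j (x j)) * \<phi> (x(b := p b)))"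
      by (simp add: mult_ac)
  qed
  finally show ?thesis by (simp add: regular_distr_def)
qed

section \<open>Second derivatives iterated along a list of variables\<close>

abbreviation distr_second_derivs :: "nat list \<Rightarrow> distr_fun \<Rightarrow> distr_fun" where
  "distr_second_derivs js T \<equiv> foldr (\<lambda>j S. distr_partial j (distr_partial j S)) js T"

text \<open>The two minus signs cancel, and the outermost derivative is the first to reach the test
  function.\<close>

lemma distr_second_derivs_Cons:
  "distr_second_derivs (j # js) T \<phi> = distr_second_derivs js T (partial_deriv j (partial_deriv j \<phi>))"
  by (simp add: distr_partial_def)

text \<open>The functionals are compared on test functions only; this suffices because
  differentiation in the variables of \<open>W\<close> never leaves that class.\<close>

lemma distr_second_derivs_cong:
  assumes "\<And>\<phi>. test_fun W \<phi> \<Longrightarrow> S \<phi> = T \<phi>" "set js \<subseteq> W" "test_fun W \<phi>"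
  shows "distr_second_derivs js S \<phi> = distr_second_derivs js T \<phi>"
  using assms(2,3)
  by (induction js arbitrary: \<phi>) (auto simp: distr_partial_def assms(1) test_fun_partial_deriv)

lemma distr_second_derivs_upd:
  assumes "b \<notin> set js"
  shows "distr_second_derivs js (\<lambda>\<psi>. c * T (\<lambda>x. \<psi> (x(b := p)))) \<phi>
    = c * distr_second_derivs js T (\<lambda>x. \<phi> (x(b := p)))"
  using assms by (induction js arbitrary: \<phi>) (auto simp: distr_partial_def partial_deriv_upd)

text \<open>The induction adds the largest index \<open>b\<close>. It comes last in the sorted list,
  so its derivatives are innermost and act directly on the regular distribution; each step yields a
  factor \<open>c b\<close> and freezes coordinate \<open>b\<close> at \<open>p b\<close>.\<close>

lemma distr_second_deriv_prod:
  assumes "finite K" "\<And>j. j \<in> K \<Longrightarrow> second_kernel (g j) (c j) (p j)" "test_fun K \<phi>"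
  shows "distr_second_deriv K (regular_distr K (\<lambda>x. \<Prod>j\<in>K. g j (x j))) \<phi>
    = (\<Prod>j\<in>K. c j) * \<phi> (restrict p K)"
  using assms
proof (induction K arbitrary: \<phi> rule: finite_linorder_max_induct)
  case empty
  \<comment> \<open>Without variables the cube is a single point of mass 1, and the pairing is
    evaluation there.\<close>
  have "open_cube {} = {\<lambda>_. undefined}" by (simp add: open_cube_def)
  then show ?case
    by (simp add: distr_second_deriv_def regular_distr_def set_lebesgue_integral_def
        PiM_empty lebesgue_integral_count_space_finite restrict_def)
next
  case (insert b K)
  have b: "b \<notin> K" using insert.hyps by blast
  let ?R = "\<lambda>K. regular_distr K (\<lambda>x. \<Prod>j\<in>K. g j (x j))"
  have "sorted_list_of_set (insert b K) = sorted_list_of_set K @ [b]"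
    using insert.hyps by (intro sorted_list_of_set_unique[THEN iffD1])
      (auto simp: sorted_wrt_append)
  then have "distr_second_deriv (insert b K) (?R (insert b K)) \<phi>
      = distr_second_derivs (sorted_list_of_set K)
          (distr_partial b (distr_partial b (?R (insert b K)))) \<phi>"
    by (simp add: distr_second_deriv_def)
  also have "\<dots> = distr_second_derivs (sorted_list_of_set K)
      (\<lambda>\<psi>. c b * ?R K (\<lambda>x. \<psi> (x(b := p b)))) \<phi>"
  proof (rule distr_second_derivs_cong[where W = "insert b K"])
    fix \<psi> assume "test_fun (insert b K) \<psi>"
    then show "distr_partial b (distr_partial b (?R (insert b K))) \<psi>
        = c b * ?R K (\<lambda>x. \<psi> (x(b := p b)))"
      using regular_distr_insert[OF insert.hyps(1) b _ insert.prems(1), of \<psi>]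
      by (simp add: distr_partial_def)
  qed (use insert in auto)
  also have "\<dots> = c b * distr_second_deriv K (?R K) (\<lambda>x. \<phi> (x(b := p b)))"
    using insert.hyps(1) b by (subst distr_second_derivs_upd) (auto simp: distr_second_deriv_def)
  also have "\<dots> = c b * ((\<Prod>j\<in>K. c j) * \<phi> ((restrict p K)(b := p b)))"
    using insert.prems b
    by (subst insert.IH) (auto intro!: test_fun_upd simp: second_kernel_def)
  also have "(restrict p K)(b := p b) = restrict p (insert b K)"
    by (auto simp: restrict_def)
  finally show ?case using insert.hyps(1) b by simp
qed

text \<open>The same differentiated test function \<open>\<psi>\<close> works for every
  \<open>T\<close>. Linearity of the pairing in the represented function therefore passes to its
  iterated derivatives.\<close>

lemma distr_second_derivs_eq:
  obtains \<psi> where "\<And>T. distr_second_derivs js T \<phi> = T \<psi>"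
    "test_fun K \<phi> \<Longrightarrow> set js \<subseteq> K \<Longrightarrow> test_fun K \<psi>"
proof -
  have "\<exists>\<psi>. (\<forall>T. distr_second_derivs js T \<phi> = T \<psi>) \<and>
    (test_fun K \<phi> \<longrightarrow> set js \<subseteq> K \<longrightarrow> test_fun K \<psi>)"
  proof (induction js arbitrary: \<phi>)
    case Nil
    show ?case by auto
  next
    case (Cons j js)
    obtain \<psi> where "\<forall>T. distr_second_derivs js T (partial_deriv j (partial_deriv j \<phi>)) = T \<psi>"
      "test_fun K (partial_deriv j (partial_deriv j \<phi>)) \<longrightarrow> set js \<subseteq> K \<longrightarrow> test_fun K \<psi>"
      using Cons by blast
    then show ?case
      unfolding distr_second_derivs_Cons
      by (intro exI[of _ \<psi>]) (auto intro!: test_fun_partial_deriv)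
  qed
  then show thesis using that by blast
qed

text \<open>All terms have their singularity at the same point \<open>p\<close>, so the evaluation
  factors out and only a sum of numerical coefficients is left to compute.\<close>

lemma distr_second_deriv_sum_prod:
  assumes fin: "finite K" and g: "\<And>u j. u \<in> S \<Longrightarrow> j \<in> K \<Longrightarrow> second_kernel (g u j) (c u j) (p j)"
    and \<phi>: "test_fun K \<phi>"
    and f: "\<And>x. x \<in> open_cube K \<Longrightarrow> f x = (\<Sum>u\<in>S. d u * (\<Prod>j\<in>K. g u j (x j)))"
  shows "distr_second_deriv K (regular_distr K f) \<phi>
    = (\<Sum>u\<in>S. d u * (\<Prod>j\<in>K. c u j)) * \<phi> (restrict p K)"
proof -
  obtain \<psi> where \<psi>: "\<And>T. distr_second_deriv K T \<phi> = T \<psi>" "test_fun K \<psi>"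
  proof (rule distr_second_derivs_eq[of "sorted_list_of_set K" \<phi> K])
    fix \<psi>
    assume "\<And>T. distr_second_derivs (sorted_list_of_set K) T \<phi> = T \<psi>"
      "test_fun K \<phi> \<Longrightarrow> set (sorted_list_of_set K) \<subseteq> K \<Longrightarrow> test_fun K \<psi>"
    with \<phi> fin show thesis by (intro that[of \<psi>]) (simp_all add: distr_second_deriv_def)
  qed
  have "regular_distr K f \<psi> = (LINT x:open_cube K|lebesgue_PiM K.
      (\<Sum>u\<in>S. d u * ((\<Prod>j\<in>K. g u j (x j)) * \<psi> x)))"
    unfolding regular_distr_def
    by (intro set_lebesgue_integral_cong sets_open_cube fin allI impI)
      (simp add: f sum_distrib_right mult.assoc)
  also have "\<dots> = (\<Sum>u\<in>S. d u * regular_distr K (\<lambda>x. \<Prod>j\<in>K. g u j (x j)) \<psi>)"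
  proof -
    have "integrable (lebesgue_PiM K)
        (\<lambda>x. d u * (indicator (open_cube K) x *\<^sub>R ((\<Prod>j\<in>K. g u j (x j)) * \<psi> x)))" if "u \<in> S" for u
      using set_integrable_prod_mult_test_fun[OF fin _ \<psi>(2), of "g u"] g[OF that]
      unfolding set_integrable_def by (intro integrable_mult_right) (auto simp: second_kernel_def)
    then show ?thesis
      unfolding regular_distr_def set_lebesgue_integral_def
      by (simp add: scaleR_sum_right sum_distrib_left mult.left_commute)
  qed
  also have "\<dots> = (\<Sum>u\<in>S. d u * ((\<Prod>j\<in>K. c u j) * \<phi> (restrict p K)))"
  proof (rule sum.cong)
    show "d u * regular_distr K (\<lambda>x. \<Prod>j\<in>K. g u j (x j)) \<psi>
        = d u * ((\<Prod>j\<in>K. c u j) * \<phi> (restrict p K))" if "u \<in> S" for u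
      using distr_second_deriv_prod[OF fin g[OF that] \<phi>] by (simp only: \<psi>(1))
  qed simp
  finally show ?thesis
    by (simp add: \<psi>(1) sum_distrib_right mult.assoc)
qed

subsection \<open>Smooth approximations of the minimum\<close>

text \<open>A smooth decreasing step for positive \<open>n\<close>. As \<open>n\<close> grows it
  approaches the derivative of min t p away from \<open>p\<close>.\<close>

definition logistic :: "real \<Rightarrow> real \<Rightarrow> real \<Rightarrow> real" where
  "logistic n p t = 1 / (1 + exp (n * (t - p)))"

text \<open>The primitive of \<open>logistic n p\<close> that is 0 at t = 0; the second logarithm is
  this normalisation, which secures the zero boundary values of \<open>C0_space\<close>.\<close>

definition softmin :: "real \<Rightarrow> real \<Rightarrow> real \<Rightarrow> real" where
  "softmin n p t = t - (ln (1 + exp (n * (t - p))) - ln (1 + exp (- n * p))) / n"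

text \<open>The derivatives of \<^const>\<open>softmin\<close> are polynomials in \<^const>\<open>logistic\<close>,
  because \<open>s = logistic n p\<close> solves \<open>s' = - n s (1 - s)\<close>.\<close>

primrec logistic_poly :: "real \<Rightarrow> nat \<Rightarrow> real poly" where
  "logistic_poly n 0 = [:0, 1:]"
| "logistic_poly n (Suc k) = pderiv (logistic_poly n k) * [:0, - n, n:]"

primrec softmin_deriv :: "real \<Rightarrow> real \<Rightarrow> nat \<Rightarrow> real \<Rightarrow> real" where
  "softmin_deriv n p 0 t = softmin n p t"
| "softmin_deriv n p (Suc k) t = poly (logistic_poly n k) (logistic n p t)"

lemma one_plus_exp_neq_0: "1 + exp z \<noteq> (0 :: real)"
  by (simp add: add_pos_pos less_imp_neq[symmetric])

lemma logistic_bounds: "0 \<le> logistic n p t" "logistic n p t \<le> 1"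
  using add_pos_pos[OF zero_less_one exp_gt_zero[of "n * (t - p)"]]
  by (simp_all add: logistic_def)

lemma DERIV_logistic:
  "(logistic n p has_real_derivative - n * logistic n p t + n * (logistic n p t)\<^sup>2) (at t)"
proof -
  define e where "e = exp (n * (t - p))"
  have e: "1 + e \<noteq> 0" unfolding e_def by (rule one_plus_exp_neq_0)
  have "((\<lambda>t. 1 + exp (n * (t - p))) has_real_derivative n * e) (at t)"
    unfolding e_def by (auto intro!: derivative_eq_intros)
  then have "((\<lambda>t. 1 / (1 + exp (n * (t - p)))) has_real_derivative
      (0 * (1 + e) - 1 * (n * e)) / ((1 + e) * (1 + e))) (at t)"
    unfolding e_def by (intro DERIV_divide DERIV_const one_plus_exp_neq_0)
  also have "(0 * (1 + e) - 1 * (n * e)) / ((1 + e) * (1 + e)) = - n * (1 / (1 + e)) + n * (1 / (1 + e))\<^sup>2"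
  proof -
    have "(0 * d - 1 * (n * (d - 1))) / (d * d) = - n * (1 / d) + n * (1 / d)\<^sup>2" if "d \<noteq> 0" for d
      using that by (simp add: field_simps power2_eq_square)
    from this[OF e] show ?thesis by simp
  qed
  finally show ?thesis unfolding logistic_def[abs_def] e_def .
qed

lemma DERIV_softmin_deriv:
  assumes "n \<noteq> 0"
  shows "(softmin_deriv n p k has_real_derivative softmin_deriv n p (Suc k) t) (at t)"
proof (cases k)
  case 0
  have pos: "1 + exp (n * (t - p)) > 0" by (simp add: add_pos_pos)
  have "(softmin n p has_real_derivative logistic n p t) (at t)"
    unfolding softmin_def[abs_def] logistic_def using pos assms
    by (auto intro!: derivative_eq_intros simp: divide_simps one_plus_exp_neq_0)
      (simp add: algebra_simps)
  then show ?thesis using 0 by (simp add: softmin_deriv.simps[abs_def])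
next
  case (Suc l)
  have "((\<lambda>t. poly (logistic_poly n l) (logistic n p t)) has_real_derivative
      poly (pderiv (logistic_poly n l)) (logistic n p t) *
        (- n * logistic n p t + n * (logistic n p t)\<^sup>2)) (at t)"
    by (rule DERIV_chain2[OF poly_DERIV DERIV_logistic])
  then show ?thesis
    using Suc by (simp add: softmin_deriv.simps[abs_def] power2_eq_square algebra_simps)
qed

lemma softmin_0: "softmin n p 0 = 0"
  by (simp add: softmin_def)

text \<open>On both sides of \<open>p\<close> the error times \<open>n\<close> is a difference of
  two values of ln (1 + exp z) with z <= 0, each between 0 and 1. For t > p this rests on ln (1 +
  exp z) = z + ln (1 + exp (-z)), whose linear part turns t into p.\<close>

lemma softmin_error:
  assumes "n > 0" "p \<ge> 0"
  shows "\<bar>softmin n p t - min t p\<bar> \<le> 1 / n"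
proof -
  have ln: "0 \<le> ln (1 + exp z)" "ln (1 + exp z) \<le> 1" if "z \<le> 0" for z :: real
  proof -
    show "0 \<le> ln (1 + exp z)" by simp
    have "ln (1 + exp z) \<le> exp z" by (intro ln_add_one_self_le_self) simp
    also have "\<dots> \<le> 1" using that by simp
    finally show "ln (1 + exp z) \<le> 1" .
  qed
  have "softmin n p t - min t p = (ln (1 + exp (- n * p)) - ln (1 + exp (- \<bar>n * (t - p)\<bar>))) / n"
  proof (cases "t \<le> p")
    case True
    then have "- \<bar>n * (t - p)\<bar> = n * (t - p)"
      using assms by (simp add: abs_of_nonpos mult_nonneg_nonpos)
    then show ?thesis using True by (simp add: softmin_def min_def diff_divide_distrib)
  next
    case False
    then have "- \<bar>n * (t - p)\<bar> = - (n * (t - p))"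
      using assms by (simp add: abs_of_nonneg)
    moreover have "ln (1 + exp (n * (t - p))) = n * (t - p) + ln (1 + exp (- (n * (t - p))))"
    proof -
      have "1 + exp (n * (t - p)) = exp (n * (t - p)) * (1 + exp (- (n * (t - p))))"
        by (simp add: distrib_left exp_minus_inverse)
      then have "ln (1 + exp (n * (t - p))) = ln (exp (n * (t - p)) * (1 + exp (- (n * (t - p)))))"
        by (rule arg_cong)
      also have "\<dots> = n * (t - p) + ln (1 + exp (- (n * (t - p))))"
        by (subst ln_mult) (auto simp: one_plus_exp_neq_0)
      finally show ?thesis .
    qed
    ultimately show ?thesis
      using False assms(1) by (simp add: softmin_def min_def field_simps)
  qed
  moreover have "\<bar>ln (1 + exp (- n * p)) - ln (1 + exp (- \<bar>n * (t - p)\<bar>))\<bar> \<le> 1"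
  proof -
    have "- n * p \<le> 0" "- \<bar>n * (t - p)\<bar> \<le> 0" using assms by simp_all
    from ln[OF this(1)] ln[OF this(2)] show ?thesis by linarith
  qed
  ultimately show ?thesis
    using assms(1) by (simp add: divide_right_mono)
qed

lemma uniform_limit_softmin:
  assumes "p \<ge> 0"
  shows "uniform_limit A (\<lambda>n. softmin (real (Suc n)) p) (\<lambda>t. min t p) sequentially"
proof (rule uniform_limitI)
  fix e :: real assume "e > 0"
  then obtain N where N: "inverse (real (Suc N)) < e" using reals_Archimedean by blast
  have "dist (softmin (real (Suc n)) p t) (min t p) < e" if "n \<ge> N" for n t
  proof -
    have "dist (softmin (real (Suc n)) p t) (min t p) \<le> 1 / real (Suc n)"
      using softmin_error[OF _ assms, of "real (Suc n)" t] by (simp add: dist_real_def)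
    also have "\<dots> \<le> inverse (real (Suc N))" using that by (simp add: field_simps)
    finally show ?thesis using N by simp
  qed
  then show "\<forall>\<^sub>F n in sequentially. \<forall>t\<in>A. dist (softmin (real (Suc n)) p t) (min t p) < e"
    unfolding eventually_sequentially by blast
qed

text \<open>For integer steepness the exponentials are powers of a fixed number, so geometric
  sequences give the limits 1 left of \<open>p\<close>, 1/2 at \<open>p\<close> and 0 right of it.
  To the right the fraction is first rewritten with the base exp (p - t) < 1.\<close>

lemma convergent_logistic: "convergent (\<lambda>n. logistic (real (Suc n)) p t)"
proof -
  have e: "exp (real (Suc n) * z) = exp z ^ Suc n" for n z
    by (rule exp_of_nat_mult)
  consider "t < p" | "t = p" | "t > p" by linarith
  then show ?thesis
  proof cases
    case 1
    then have "(\<lambda>n. exp (t - p) ^ Suc n) \<longlonglongrightarrow> 0"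
      by (intro LIMSEQ_Suc LIMSEQ_power_zero) simp
    then have "(\<lambda>n. 1 / (1 + exp (t - p) ^ Suc n)) \<longlonglongrightarrow> 1 / (1 + 0)"
      by (intro tendsto_intros) auto
    then show ?thesis unfolding logistic_def e convergent_def by blast
  next
    case 2
    then show ?thesis by (simp add: logistic_def convergent_const)
  next
    case 3
    then have "(\<lambda>n. exp (p - t) ^ Suc n) \<longlonglongrightarrow> 0"
      by (intro LIMSEQ_Suc LIMSEQ_power_zero) simp
    then have "(\<lambda>n. exp (p - t) ^ Suc n / (exp (p - t) ^ Suc n + 1)) \<longlonglongrightarrow> 0 / (0 + 1)"
      by (intro tendsto_intros) auto
    moreover have "logistic (real (Suc n)) p t = exp (p - t) ^ Suc n / (exp (p - t) ^ Suc n + 1)" for n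
    proof -
      define z where "z = real (Suc n) * (p - t)"
      have "real (Suc n) * (t - p) = - z" by (simp add: z_def algebra_simps)
      moreover have "1 / (1 + exp (- z)) = exp z / (exp z + 1)"
        using one_plus_exp_neq_0[of z] one_plus_exp_neq_0[of "- z"]
        by (simp add: frac_eq_eq distrib_left exp_minus_inverse add.commute)
      ultimately show ?thesis
        unfolding logistic_def e[symmetric] z_def by simp
    qed
    ultimately show ?thesis unfolding convergent_def by auto
  qed
qed

subsection \<open>Membership in the Hilbert space\<close>

lemma H_norm_jet_diff:
  assumes "finite K" "jet K (unit_cube K) (D p)" "jet K (unit_cube K) (D q)"
  shows "H_norm K (\<lambda>x. D p (\<lambda>_. 0) x - D q (\<lambda>_. 0) x)
    = sqrt (LINT x:unit_cube K|lebesgue_PiM K.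
        (D p (\<lambda>j. if j \<in> K then 1 else 0) x - D q (\<lambda>j. if j \<in> K then 1 else 0) x)\<^sup>2)"
proof -
  have "mixed_deriv K (\<lambda>x. D p (\<lambda>_. 0) x - D q (\<lambda>_. 0) x) x
      = D p (\<lambda>j. if j \<in> K then 1 else 0) x - D q (\<lambda>j. if j \<in> K then 1 else 0) x"
    if "x \<in> unit_cube K" for x
    by (rule mixed_deriv_jet[OF jet_diff[OF assms(2,3)] slice_open_unit_cube[OF subset_refl] refl
          assms(1) that])
  then have "(LINT x:unit_cube K|lebesgue_PiM K. mixed_deriv K (\<lambda>x. D p (\<lambda>_. 0) x - D q (\<lambda>_. 0) x) x *
        mixed_deriv K (\<lambda>x. D p (\<lambda>_. 0) x - D q (\<lambda>_. 0) x) x)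
    = (LINT x:unit_cube K|lebesgue_PiM K.
        (D p (\<lambda>j. if j \<in> K then 1 else 0) x - D q (\<lambda>j. if j \<in> K then 1 else 0) x)\<^sup>2)"
    unfolding set_lebesgue_integral_def
    by (intro Bochner_Integration.integral_cong refl) (auto simp: indicator_def power2_eq_square)
  then show ?thesis by (simp add: H_norm_def H_inner_def)
qed

text \<open>Top mixed derivatives that are uniformly bounded and converge pointwise converge in mean
  square on the cube, by dominated convergence. Hence the approximants are Cauchy in the Hilbert
  norm, and their uniform limit lies in the space.\<close>

lemma H_spaceI:
  assumes fin: "finite K" and D: "\<And>n. jet K (unit_cube K) (D n)"
    and zero: "\<And>n x j. x \<in> unit_cube K \<Longrightarrow> j \<in> K \<Longrightarrow> x j = 0 \<Longrightarrow> D n (\<lambda>_. 0) x = 0"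
    and conv: "\<And>x. x \<in> unit_cube K \<Longrightarrow> convergent (\<lambda>n. D n (\<lambda>j. if j \<in> K then 1 else 0) x)"
    and bound: "\<And>n x. x \<in> unit_cube K \<Longrightarrow> \<bar>D n (\<lambda>j. if j \<in> K then 1 else 0) x\<bar> \<le> B"
    and lim: "uniform_limit (unit_cube K) (\<lambda>n. D n (\<lambda>_. 0)) f sequentially"
  shows "f \<in> H_space K"
proof -
  let ?M = "lebesgue_PiM K"
  define E where "E n x = indicator (unit_cube K) x * D n (\<lambda>j. if j \<in> K then 1 else 0) x" for n x
  define L where "L x = lim (\<lambda>n. E n x)" for x
  have cube: "unit_cube K \<in> sets ?M"
    unfolding unit_cube_def using fin by (intro sets_PiM_I_finite) auto
  have E_int: "integrable ?M (E n)" for n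
  proof -
    have "set_integrable ?M (unit_cube K) (D n (\<lambda>j. if j \<in> K then 1 else 0))"
      using D[of n] bound unfolding jet_def by (intro set_integrable_unit_cube[OF fin]) auto
    then show ?thesis by (simp add: set_integrable_def E_def[abs_def])
  qed
  have [measurable]: "E n \<in> borel_measurable ?M" for n using E_int by auto
  have E_lim: "(\<lambda>n. E n x) \<longlonglongrightarrow> L x" for x
  proof -
    have "convergent (\<lambda>n. E n x)"
      using conv[of x] by (cases "x \<in> unit_cube K") (auto simp: E_def convergent_const)
    then show ?thesis unfolding L_def by (simp add: convergent_LIMSEQ_iff)
  qed
  have [measurable]: "L \<in> borel_measurable ?M"
    by (rule borel_measurable_LIMSEQ_real[of _ E]) (auto intro: E_lim)
  define w where "w x = indicator (unit_cube K) x * \<bar>B\<bar>" for x :: "nat \<Rightarrow> real"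
  have E_bound: "\<bar>E n x\<bar> \<le> w x" for n x
    using bound[of x n] by (auto simp: E_def w_def indicator_def)
  have L_bound: "\<bar>L x\<bar> \<le> w x" for x
    by (rule LIMSEQ_le_const2[OF tendsto_rabs[OF E_lim]]) (auto intro: E_bound)
  have w_int: "integrable ?M (\<lambda>x. c * (w x)\<^sup>2)" for c
  proof -
    have "set_integrable ?M (unit_cube K) (\<lambda>x. c * \<bar>B\<bar>\<^sup>2)"
      by (rule set_integrable_unit_cube[OF fin _ order_refl]) simp
    then show ?thesis
      unfolding set_integrable_def
      by (rule Bochner_Integration.integrable_cong[THEN iffD1, rotated -1])
        (auto simp: w_def indicator_def)
  qed
  \<comment> \<open>Serves twice: to dominate the squared distance to the limit, and in place of the
    triangle inequality in the Cauchy estimate.\<close>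
  have sq: "(u - v)\<^sup>2 \<le> 2 * u\<^sup>2 + 2 * v\<^sup>2" for u v :: real
    using sum_squares_bound[of u "- v"] by (simp add: power2_diff)
  have EL_bound: "(E n x - L x)\<^sup>2 \<le> 4 * (w x)\<^sup>2" for n x
  proof -
    have "(E n x)\<^sup>2 \<le> (w x)\<^sup>2" "(L x)\<^sup>2 \<le> (w x)\<^sup>2"
      using power_mono[OF E_bound[of n x], of 2] power_mono[OF L_bound[of x], of 2] by simp_all
    then show ?thesis using sq[of "E n x" "L x"] by linarith
  qed
  have EL_int: "integrable ?M (\<lambda>x. (E n x - L x)\<^sup>2)" for n
    by (rule Bochner_Integration.integrable_bound[OF w_int[of 4]]) (auto simp: EL_bound)
  define I where "I n = (LINT x|?M. (E n x - L x)\<^sup>2)" for n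
  have "I \<longlonglongrightarrow> (LINT x|?M. 0)"
    unfolding I_def
  proof (rule integral_dominated_convergence[where w = "\<lambda>x. 4 * (w x)\<^sup>2"])
    have "(\<lambda>n. (E n x - L x)\<^sup>2) \<longlonglongrightarrow> (L x - L x)\<^sup>2" for x
      by (intro tendsto_intros E_lim)
    then show "AE x in ?M. (\<lambda>n. (E n x - L x)\<^sup>2) \<longlonglongrightarrow> 0" by simp
    show "integrable ?M (\<lambda>x. 4 * (w x)\<^sup>2)" by (rule w_int)
    show "AE x in ?M. norm ((E n x - L x)\<^sup>2) \<le> 4 * (w x)\<^sup>2" for n
      by (simp add: EL_bound)
  qed measurable
  then have I: "I \<longlonglongrightarrow> 0" by simp
  have norm: "(H_norm K (\<lambda>x. D p (\<lambda>_. 0) x - D q (\<lambda>_. 0) x))\<^sup>2 \<le> 2 * I p + 2 * I q" for p q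
  proof -
    have eq: "H_norm K (\<lambda>x. D p (\<lambda>_. 0) x - D q (\<lambda>_. 0) x) = sqrt (LINT x|?M. (E p x - E q x)\<^sup>2)"
      unfolding H_norm_jet_diff[where D = D, OF fin D D] set_lebesgue_integral_def
      by (intro arg_cong[where f = sqrt] Bochner_Integration.integral_cong refl)
        (auto simp: E_def indicator_def)
    have le: "(E p x - E q x)\<^sup>2 \<le> 2 * (E p x - L x)\<^sup>2 + 2 * (E q x - L x)\<^sup>2" for x
      using sq[of "E p x - L x" "E q x - L x"] by simp
    have R: "integrable ?M (\<lambda>x. 2 * (E p x - L x)\<^sup>2 + 2 * (E q x - L x)\<^sup>2)"
      using EL_int by auto
    have "integrable ?M (\<lambda>x. (E p x - E q x)\<^sup>2)"
      by (rule Bochner_Integration.integrable_bound[OF R]) (auto simp: le)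
    from integral_mono[OF this R le]
    show ?thesis
      unfolding eq I_def using EL_int by (simp add: integral_nonneg_AE)
  qed
  have "\<exists>N. \<forall>p\<ge>N. \<forall>q\<ge>N. H_norm K (\<lambda>x. D p (\<lambda>_. 0) x - D q (\<lambda>_. 0) x) < e" if e: "e > 0" for e
  proof -
    \<comment> \<open>With the threshold e^2 / 4 the bound 2 I p + 2 I q stays below e^2.\<close>
    obtain N where N: "\<And>n. n \<ge> N \<Longrightarrow> I n < e\<^sup>2 / 4"
      using order_tendstoD(2)[OF I, of "e\<^sup>2 / 4"] e by (auto simp: eventually_sequentially)
    have "H_norm K (\<lambda>x. D p (\<lambda>_. 0) x - D q (\<lambda>_. 0) x) < e" if "p \<ge> N" "q \<ge> N" for p q
      using norm[of p q] N[OF that(1)] N[OF that(2)] e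
      by (intro power_less_imp_less_base[of _ 2 e]) linarith+
    then show ?thesis by blast
  qed
  moreover have "D n (\<lambda>_. 0) \<in> C0_space K" for n
    using zero jet_C_class[OF D slice_open_unit_cube[OF subset_refl]] by (auto simp: C0_space_def)
  ultimately show ?thesis
    using lim unfolding H_space_def by (intro CollectI exI[of _ "\<lambda>n. D n (\<lambda>_. 0)"] conjI allI impI)
qed

subsection \<open>The Green function as a sum of products\<close>

text \<open>Minus the extension of \<open>a\<close> by the value -1 at the empty set, so that the
  leading product becomes one more term of the sum.\<close>

definition green_coeff :: "(nat set \<Rightarrow> real) \<Rightarrow> nat set \<Rightarrow> real" where
  "green_coeff a U = (if U = {} then 1 else - a U)"

lemma green_eq_sum_prod:
  assumes "finite K" "\<M> \<subseteq> Pow K - {{}}"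
  shows "green K \<M> a x \<xi> = (\<Sum>U\<in>insert {} \<M>. green_coeff a U *
    (\<Prod>j\<in>K. if j \<in> U then x j * \<xi> j else min (x j) (\<xi> j)))"
proof -
  have fin: "finite \<M>" "{} \<notin> \<M>" using assms by (auto intro: finite_subset)
  have "(\<Prod>j\<in>K. if j \<in> U then x j * \<xi> j else min (x j) (\<xi> j))
      = (\<Prod>j\<in>K - U. min (x j) (\<xi> j)) * (\<Prod>j\<in>U. x j * \<xi> j)" if "U \<in> \<M>" for U
  proof -
    have "K \<inter> {j. j \<in> U} = U" "K \<inter> - {j. j \<in> U} = K - U" using that assms(2) by auto
    then show ?thesis using assms(1) by (simp add: prod.If_cases mult.commute)
  qed
  then have "(\<Sum>U\<in>\<M>. green_coeff a U * (\<Prod>j\<in>K. if j \<in> U then x j * \<xi> j else min (x j) (\<xi> j)))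
      = (\<Sum>U\<in>\<M>. - (a U * (\<Prod>j\<in>K - U. min (x j) (\<xi> j)) * (\<Prod>j\<in>U. x j * \<xi> j)))"
    using fin(2) by (intro sum.cong) (auto simp: green_coeff_def)
  then show ?thesis
    using fin by (simp add: green_def green_coeff_def sum_negf)
qed

subsection \<open>The essential boundary conditions\<close>

text \<open>Upward closure puts the union of \<open>U\<close> and \<open>T\<close> into the family,
  and the recurrence there says that the fibres over all subsets of \<open>T\<close> sum to 1 in
  total. By strong induction the proper subsets already account for 1 if \<open>T\<close> is
  nonempty, through the empty subset, and for 0 otherwise.\<close>

lemma sum_coeffs_fibre:
  fixes a :: "nat set \<Rightarrow> real"
  assumes "finite M" "\<M> \<subseteq> Pow M"
    and up: "\<And>U V. U \<in> \<M> \<Longrightarrow> U \<subseteq> V \<Longrightarrow> V \<subseteq> M \<Longrightarrow> V \<in> \<M>"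
    and coeffs: "\<And>U. U \<in> \<M> \<Longrightarrow> (\<Sum>V\<in>{V \<in> \<M>. V \<subseteq> U}. a V) = 1"
    and U: "U \<in> \<M>" and "T \<subseteq> M - U"
  shows "(\<Sum>W\<in>{W \<in> \<M>. W - U = T}. a W) = (if T = {} then 1 else 0)"
proof -
  have fin: "finite \<M>" using assms(1,2) by (meson finite_Pow_iff finite_subset)
  have "finite T" using assms(1,6) by (meson finite_Diff finite_subset)
  then show ?thesis using \<open>T \<subseteq> M - U\<close>
  proof (induction T rule: finite_psubset_induct)
    case (psubset T)
    have "1 = (\<Sum>W\<in>{W \<in> \<M>. W \<subseteq> U \<union> T}. a W)"
      using psubset.prems assms(2) U by (intro coeffs[symmetric] up[OF U]) auto
    also have "\<dots> = (\<Sum>T'\<in>Pow T. \<Sum>W\<in>{W \<in> {W \<in> \<M>. W \<subseteq> U \<union> T}. W - U = T'}. a W)"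
      using fin psubset.hyps by (intro sum.group[symmetric]) auto
    also have "\<dots> = (\<Sum>T'\<in>Pow T. \<Sum>W\<in>{W \<in> \<M>. W - U = T'}. a W)"
      by (intro sum.cong) auto
    also have "\<dots> = (\<Sum>W\<in>{W \<in> \<M>. W - U = T}. a W) +
        (\<Sum>T'\<in>Pow T - {T}. \<Sum>W\<in>{W \<in> \<M>. W - U = T'}. a W)"
      using psubset.hyps by (intro sum.remove) auto
    also have "(\<Sum>T'\<in>Pow T - {T}. \<Sum>W\<in>{W \<in> \<M>. W - U = T'}. a W)
        = (\<Sum>T'\<in>Pow T - {T}. if T' = {} then 1 else 0)"
      using psubset.prems by (intro sum.cong psubset.IH) auto
    also have "\<dots> = (if T = {} then 0 else 1)"
      using psubset.hyps by (auto simp: sum.delta)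
    finally show ?case by (auto split: if_splits)
  qed
qed

lemma green_face:
  fixes a :: "nat set \<Rightarrow> real"
  assumes "finite M" "\<M> \<subseteq> Pow M - {{}}"
    and up: "\<And>U V. U \<in> \<M> \<Longrightarrow> U \<subseteq> V \<Longrightarrow> V \<subseteq> M \<Longrightarrow> V \<in> \<M>"
    and coeffs: "\<And>U. U \<in> \<M> \<Longrightarrow> (\<Sum>V\<in>{V \<in> \<M>. V \<subseteq> U}. a V) = 1"
    and U: "U \<in> \<M>" and x: "\<And>i. i \<in> U \<Longrightarrow> x i = 1" and \<xi>: "\<And>i. i \<in> M \<Longrightarrow> \<xi> i \<le> 1"
  shows "green M \<M> a x \<xi> = 0"
proof -
  have sub: "\<M> \<subseteq> Pow M" "{} \<notin> \<M>" using assms(2) by auto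
  have fin: "finite \<M>" using assms(1) sub by (meson finite_Pow_iff finite_subset)
  \<comment> \<open>For \<open>j\<close> in \<open>U\<close> both kernels equal
    \<open>\<xi> j\<close>, since \<open>x j\<close> is 1 and \<open>\<xi> j\<close> is at most 1;
    only the part of the index set outside \<open>U\<close> remains visible.\<close>
  define Q where "Q T = (\<Prod>j\<in>M. if j \<in> U then \<xi> j else if j \<in> T then x j * \<xi> j else min (x j) (\<xi> j))" for T
  have Q: "(\<Prod>j\<in>M. if j \<in> W then x j * \<xi> j else min (x j) (\<xi> j)) = Q (W - U)" for W
    unfolding Q_def using x \<xi> by (intro prod.cong) auto
  have "(\<Sum>W\<in>\<M>. a W * Q (W - U)) = (\<Sum>T\<in>Pow (M - U). \<Sum>W\<in>{W \<in> \<M>. W - U = T}. a W * Q (W - U))"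
    using fin assms(1) sub by (intro sum.group[symmetric]) auto
  also have "\<dots> = (\<Sum>T\<in>Pow (M - U). (\<Sum>W\<in>{W \<in> \<M>. W - U = T}. a W) * Q T)"
    unfolding sum_distrib_right by (intro sum.cong) auto
  also have "\<dots> = (\<Sum>T\<in>Pow (M - U). if T = {} then Q T else 0)"
    using sum_coeffs_fibre[OF assms(1) sub(1) up coeffs U] by (intro sum.cong) auto
  also have "\<dots> = Q {}"
    using assms(1) by (simp add: sum.delta')
  finally have "(\<Sum>W\<in>\<M>. a W * Q (W - U)) = Q {}" .
  moreover have "(\<Sum>W\<in>\<M>. green_coeff a W * Q (W - U)) = - (\<Sum>W\<in>\<M>. a W * Q (W - U))"
    unfolding sum_negf[symmetric] using sub(2) by (intro sum.cong) (auto simp: green_coeff_def)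
  ultimately show ?thesis
    using fin sub(2) by (simp add: green_eq_sum_prod[OF assms(1,2)] Q green_coeff_def)
qed

subsection \<open>Verification of the three conditions\<close>

fun linear_deriv :: "real \<Rightarrow> nat \<Rightarrow> real \<Rightarrow> real" where
  "linear_deriv r 0 t = t * r"
| "linear_deriv r (Suc 0) t = r"
| "linear_deriv r (Suc (Suc _)) t = 0"

lemma DERIV_linear_deriv:
  "(linear_deriv r k has_real_derivative linear_deriv r (Suc k) t) (at t)"
proof (cases "(r, k, t)" rule: linear_deriv.cases)
  case (1 r t)
  have "((\<lambda>t. t * r) has_real_derivative r) (at t)" by (auto intro!: derivative_eq_intros)
  then show ?thesis using 1 by (simp add: linear_deriv.simps[abs_def])
qed (simp_all add: linear_deriv.simps[abs_def])

lemma uniform_limit_lincomb: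
  fixes c :: "'a \<Rightarrow> real"
  assumes "finite S" "\<And>u. u \<in> S \<Longrightarrow> uniform_limit A (f u) (g u) F"
  shows "uniform_limit A (\<lambda>n x. \<Sum>u\<in>S. c u * f u n x) (\<lambda>x. \<Sum>u\<in>S. c u * g u x) F"
  using assms
proof (induction S rule: finite_induct)
  case empty
  then show ?case by (simp add: uniform_limit_const)
next
  case (insert u S)
  have "uniform_limit A (\<lambda>n x. c u * f u n x) (\<lambda>x. c u * g u x) F"
    using insert.prems by (intro bounded_linear.uniform_limit[OF bounded_linear_mult_right]) simp
  with insert show ?case by (simp add: uniform_limit_add)
qed

context
  fixes M :: "nat set" and \<M> :: "nat set set" and a :: "nat set \<Rightarrow> real" and \<xi> :: "nat \<Rightarrow> real"
  assumes finM: "finite M" and family: "\<M> \<subseteq> Pow M - {{}}" and \<xi>: "\<xi> \<in> open_cube M"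
begin

lemma finite_family: "finite \<M>"
  using finM family by (meson Diff_subset finite_Pow_iff finite_subset)

lemma \<xi>_bounds: "j \<in> M \<Longrightarrow> 0 < \<xi> j" "j \<in> M \<Longrightarrow> \<xi> j < 1"
  using \<xi> by (auto simp: open_cube_def dest: PiE_mem)

lemma second_kernel_factor:
  assumes "j \<in> M"
  shows "second_kernel (\<lambda>t. if j \<in> U then t * \<xi> j else min t (\<xi> j)) (if j \<in> U then 0 else - 1) (\<xi> j)"
  using second_kernel_linear second_kernel_min \<xi>_bounds[OF assms] by auto

lemma green_equation:
  assumes "test_fun M \<phi>"
  shows "(- 1) ^ card M * distr_second_deriv M (regular_distr M (\<lambda>x. green M \<M> a x \<xi>)) \<phi>
    = dirac_distr \<xi> \<phi>"
proof -
  have "distr_second_deriv M (regular_distr M (\<lambda>x. green M \<M> a x \<xi>)) \<phi>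
      = (\<Sum>U\<in>insert {} \<M>. green_coeff a U * (\<Prod>j\<in>M. if j \<in> U then 0 else - 1)) * \<phi> (restrict \<xi> M)"
    by (rule distr_second_deriv_sum_prod[OF finM second_kernel_factor assms
          green_eq_sum_prod[OF finM family]])
  also have "(\<Sum>U\<in>insert {} \<M>. green_coeff a U * (\<Prod>j\<in>M. if j \<in> U then 0 else - 1)) = (- 1) ^ card M"
  proof -
    have "(\<Prod>j\<in>M. if j \<in> U then 0 else - 1 :: real) = 0" if "U \<in> \<M>" for U
      using that family finM by (intro prod_zero) auto
    then show ?thesis
      using finite_family family by (subst sum.insert) (auto simp: green_coeff_def)
  qed
  also have "restrict \<xi> M = \<xi>"
    using \<xi> by (simp add: open_cube_def PiE_iff extensional_restrict)
  finally show ?thesis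
    by (simp add: dirac_distr_def mult.assoc[symmetric] power_mult_distrib[symmetric])
qed

lemma green_in_H_space: "(\<lambda>x. green M \<M> a x \<xi>) \<in> H_space M"
proof -
  \<comment> \<open>Only the kinked factors are smoothed; the linear ones stay exact. The steepness
    \<open>Suc n\<close> is never zero, as the division in \<open>softmin\<close> demands.\<close>
  define g where "g n U j k = (if j \<in> U then linear_deriv (\<xi> j) k
    else softmin_deriv (real (Suc n)) (\<xi> j) k)" for n U j k
  define D where "D n \<alpha> x = (\<Sum>U\<in>insert {} \<M>. green_coeff a U * (\<Prod>j\<in>M. g n U j (\<alpha> j) (x j)))"
    for n and \<alpha> :: "nat \<Rightarrow> nat" and x :: "nat \<Rightarrow> real"
  have g_deriv: "(g n U j k has_real_derivative g n U j (Suc k) t) (at t within A)" for n U j k t A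
    unfolding g_def using DERIV_linear_deriv DERIV_softmin_deriv
    by (auto intro: has_field_derivative_at_within simp del: linear_deriv.simps softmin_deriv.simps)
  \<comment> \<open>The top mixed derivative takes one derivative in each variable. All resulting
    factors lie between 0 and 1, whence a bound independent of \<open>n\<close>.\<close>
  have one: "(\<Prod>j\<in>M. g n U j (if j \<in> M then 1 else 0) (x j))
      = (\<Prod>j\<in>M. if j \<in> U then \<xi> j else logistic (real (Suc n)) (\<xi> j) (x j))" for n U x
    by (intro prod.cong) (auto simp: g_def)
  show ?thesis
  proof (rule H_spaceI[where D = D, OF finM])
    show "jet M (unit_cube M) (D n)" for n
      unfolding D_def
      by (intro jet_sum jet_prod finM order_refl g_deriv
          DERIV_continuous_on[OF g_deriv])
    show "D n (\<lambda>_. 0) x = 0" if "j \<in> M" "x j = 0" for n x j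
      unfolding D_def using that finM
      by (intro sum.neutral ballI mult_eq_0_iff[THEN iffD2] disjI2 prod_zero bexI[of _ j])
        (auto simp: g_def softmin_0)
    show "convergent (\<lambda>n. D n (\<lambda>j. if j \<in> M then 1 else 0) x)" for x
    proof -
      have "(\<lambda>n. if j \<in> U then \<xi> j else logistic (real (Suc n)) (\<xi> j) (x j)) \<longlonglongrightarrow>
          (if j \<in> U then \<xi> j else lim (\<lambda>n. logistic (real (Suc n)) (\<xi> j) (x j)))" for U j
        using convergent_logistic[of "\<xi> j" "x j"]
        by (auto simp only: convergent_LIMSEQ_iff if_True if_False intro: tendsto_const split: if_split)
      then have "(\<lambda>n. D n (\<lambda>j. if j \<in> M then 1 else 0) x) \<longlonglongrightarrow> (\<Sum>U\<in>insert {} \<M>. green_coeff a U *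
          (\<Prod>j\<in>M. if j \<in> U then \<xi> j else lim (\<lambda>n. logistic (real (Suc n)) (\<xi> j) (x j))))"
        unfolding D_def one by (intro tendsto_sum tendsto_mult_left tendsto_prod) simp
      then show ?thesis unfolding convergent_def by blast
    qed
    show "\<bar>D n (\<lambda>j. if j \<in> M then 1 else 0) x\<bar> \<le> (\<Sum>U\<in>insert {} \<M>. \<bar>green_coeff a U\<bar>)" for n x
    proof -
      have "\<bar>D n (\<lambda>j. if j \<in> M then 1 else 0) x\<bar> \<le> (\<Sum>U\<in>insert {} \<M>. \<bar>green_coeff a U *
          (\<Prod>j\<in>M. if j \<in> U then \<xi> j else logistic (real (Suc n)) (\<xi> j) (x j))\<bar>)"
        unfolding D_def one by (rule sum_abs)
      also have "\<dots> \<le> (\<Sum>U\<in>insert {} \<M>. \<bar>green_coeff a U\<bar>)"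
      proof (rule sum_mono)
        fix U
        have "\<bar>\<Prod>j\<in>M. if j \<in> U then \<xi> j else logistic (real (Suc n)) (\<xi> j) (x j)\<bar> \<le> 1"
          unfolding abs_prod using \<xi>_bounds logistic_bounds
          by (intro prod_le_1) (auto simp: less_imp_le)
        then show "\<bar>green_coeff a U * (\<Prod>j\<in>M. if j \<in> U then \<xi> j
            else logistic (real (Suc n)) (\<xi> j) (x j))\<bar> \<le> \<bar>green_coeff a U\<bar>"
          unfolding abs_mult by (intro mult_left_le) auto
      qed
      finally show ?thesis .
    qed
    have factor: "uniform_limit (unit_cube M) (\<lambda>n x. g n U j 0 (x j))
        (\<lambda>x. if j \<in> U then x j * \<xi> j else min (x j) (\<xi> j)) sequentially" if "j \<in> M" for U j
    proof (cases "j \<in> U")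
      case True
      then show ?thesis by (simp add: g_def uniform_limit_const)
    next
      case False
      have "uniform_limit (unit_cube M) (\<lambda>n x. softmin (real (Suc n)) (\<xi> j) (x j))
          (\<lambda>x. min (x j) (\<xi> j)) sequentially"
        using \<xi>_bounds(1)[OF that]
        by (intro uniform_limit_compose'[OF uniform_limit_softmin[of _ UNIV]]) auto
      then show ?thesis using False by (simp add: g_def)
    qed
    \<comment> \<open>Uniform convergence passes to products only for bounded limits; partial
      products over \<open>J\<close> are treated because the factors are multiplied in one at a
      time.\<close>
    have bounded: "bounded ((\<lambda>x. \<Prod>j\<in>J. if j \<in> U then x j * \<xi> j else min (x j) (\<xi> j)) ` unit_cube M)"
      if "J \<subseteq> M" for U J
    proof -
      have "\<bar>\<Prod>j\<in>J. if j \<in> U then x j * \<xi> j else min (x j) (\<xi> j)\<bar> \<le> 1" if "x \<in> unit_cube M" for x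
      proof -
        have "0 \<le> x j \<and> x j \<le> 1" if "j \<in> J" for j
          using \<open>x \<in> unit_cube M\<close> that \<open>J \<subseteq> M\<close> by (auto simp: unit_cube_def PiE_iff)
        then show ?thesis
          unfolding abs_prod using \<xi>_bounds \<open>J \<subseteq> M\<close>
          by (intro prod_le_1) (auto simp: less_imp_le mult_le_one subset_iff abs_mult min_le_iff_disj)
      qed
      then show ?thesis unfolding bounded_iff by auto
    qed
    have "uniform_limit (unit_cube M) (\<lambda>n x. \<Prod>j\<in>J. g n U j 0 (x j))
        (\<lambda>x. \<Prod>j\<in>J. if j \<in> U then x j * \<xi> j else min (x j) (\<xi> j)) sequentially"
      if "J \<subseteq> M" for U J
      using finite_subset[OF that finM] that
    proof (induction J rule: finite_induct)
      case empty
      then show ?case by (simp add: uniform_limit_const)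
    next
      case (insert i J)
      then show ?case
        using uniform_lim_mult[OF factor[of i U] insert.IH _ bounded[of J U]] bounded[of "{i}" U]
        by simp
    qed
    then have "uniform_limit (unit_cube M) (\<lambda>n. D n (\<lambda>_. 0)) (\<lambda>x. \<Sum>U\<in>insert {} \<M>.
        green_coeff a U * (\<Prod>j\<in>M. if j \<in> U then x j * \<xi> j else min (x j) (\<xi> j))) sequentially"
      unfolding D_def
      using finite_family by (intro uniform_limit_lincomb) auto
    then show "uniform_limit (unit_cube M) (\<lambda>n. D n (\<lambda>_. 0)) (\<lambda>x. green M \<M> a x \<xi>) sequentially"
      by (simp only: green_eq_sum_prod[OF finM family])
  qed
qed

lemma green_natural_bc:
  assumes V: "V \<subseteq> M" "V \<noteq> {}" "V \<notin> \<M>"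
  shows "natural_bc M V (\<lambda>x. green M \<M> a x \<xi>)"
proof -
  let ?S = "insert {} \<M>"
  \<comment> \<open>The least distance of a coordinate of \<open>\<xi>\<close> in \<open>V\<close>
    from 1. Within this distance of the face, min (x j) (\<open>\<xi> j\<close>) is the constant
    \<open>\<xi> j\<close> for every \<open>j\<close> in \<open>V\<close>.\<close>
  define \<epsilon> where "\<epsilon> = Min ((\<lambda>i. 1 - \<xi> i) ` V)"
  have finV: "finite V" using V(1) finM finite_subset by blast
  have \<epsilon>: "\<epsilon> > 0" "\<And>i. i \<in> V \<Longrightarrow> \<xi> i \<le> 1 - \<epsilon>"
  proof -
    show "\<epsilon> > 0"
      unfolding \<epsilon>_def using finV V \<xi>_bounds(2) by (subst Min_gr_iff) auto
    have "\<epsilon> \<le> 1 - \<xi> i" if "i \<in> V" for i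
      unfolding \<epsilon>_def using finV that by (intro Min_le) auto
    then show "\<And>i. i \<in> V \<Longrightarrow> \<xi> i \<le> 1 - \<epsilon>" by fastforce
  qed
  define A where "A = {x \<in> unit_cube M. \<forall>i\<in>V. 1 - \<epsilon> < x i}"
  have A: "slice_open V A"
  proof -
    have eq: "A = {x \<in> unit_cube M. x \<in> (\<Inter>i\<in>V. (\<lambda>x. x i) -` {1 - \<epsilon><..})}"
      by (auto simp: A_def)
    have "open (\<Inter>i\<in>V. (\<lambda>x :: nat \<Rightarrow> real. x i) -` {1 - \<epsilon><..})"
      using finV by (intro open_INT ballI open_vimage continuous_on_product_coordinates) auto
    then show ?thesis
      unfolding eq
      by (rule slice_open_inter_continuous[OF slice_open_unit_cube[OF V(1)] continuous_on_id])
  qed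
  \<comment> \<open>In the variables of \<open>V\<close> the kernel min is replaced by the constant
    that it equals on \<open>A\<close>, which is smooth on the whole interval. For \<open>j\<close>
    outside both \<open>U\<close> and \<open>V\<close> the entry 0 at positive order is a default
    that keeps the family continuous.\<close>
  define g where "g U j k t = (if j \<in> U then linear_deriv (\<xi> j) k t
    else if 0 < k then 0 else if j \<in> V then \<xi> j else min t (\<xi> j))" for U j k t
  define D where "D \<alpha> x = (\<Sum>U\<in>?S. green_coeff a U * (\<Prod>j\<in>M. g U j (\<alpha> j) (x j)))"
    for \<alpha> :: "nat \<Rightarrow> nat" and x :: "nat \<Rightarrow> real"
  have "jet V (unit_cube M) D"
    unfolding D_def
  proof (intro jet_sum jet_prod finM V(1))
    show "continuous_on {0..1} (g U j k)" for U j k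
    proof (cases "j \<in> U")
      case True
      then show ?thesis
        using DERIV_continuous_on[OF has_field_derivative_at_within[OF DERIV_linear_deriv]]
        by (simp add: g_def[abs_def])
    next
      case False
      then show ?thesis
        by (cases "k = 0"; cases "j \<in> V") (auto simp: g_def[abs_def] intro!: continuous_intros)
    qed
    show "(g U j k has_real_derivative g U j (Suc k) t) (at t within {0..1})" if "j \<in> V" for U j k t
    proof (cases "j \<in> U")
      case True
      then show ?thesis
        using has_field_derivative_at_within[OF DERIV_linear_deriv] by (simp add: g_def[abs_def])
    next
      case False
      with that show ?thesis by (cases "k = 0") (simp_all add: g_def[abs_def])
    qed
  qed
  then have D: "jet V A D" unfolding jet_def A_def by (auto intro: continuous_on_subset)
  have green: "green M \<M> a x \<xi> = D (\<lambda>_. 0) x" if x: "x \<in> A" for x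
  proof -
    have "min (x j) (\<xi> j) = \<xi> j" if "j \<in> V" for j
      using x that \<epsilon>(2)[OF that] by (auto simp: A_def min_def)
    then show ?thesis
      unfolding green_eq_sum_prod[OF finM family] D_def
      by (intro sum.cong refl arg_cong2[where f = "(*)"] prod.cong) (auto simp: g_def)
  qed
  have "C_class r V A (\<lambda>x. green M \<M> a x \<xi>)" for r
    by (rule C_class_cong[OF A jet_C_class[OF D A]]) (simp add: green)
  moreover have "distr_second_deriv (M - V) (regular_distr (M - V)
      (\<lambda>y. mixed_deriv V (\<lambda>x. green M \<M> a x \<xi>) (\<lambda>i. if i \<in> V then 1 else y i))) \<phi> = 0"
    if \<phi>: "test_fun (M - V) \<phi>" for \<phi>
  proof -
    \<comment> \<open>The factors from \<open>V\<close> at the face: \<open>\<xi> j\<close> for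
      \<open>j\<close> in \<open>U\<close> and 0 otherwise, so \<open>d U\<close> vanishes unless
      \<open>U\<close> contains \<open>V\<close>.\<close>
    define d where "d U = green_coeff a U * (\<Prod>j\<in>V. g U j 1 1)" for U
    have "mixed_deriv V (\<lambda>x. green M \<M> a x \<xi>) (\<lambda>i. if i \<in> V then 1 else y i)
        = (\<Sum>U\<in>?S. d U * (\<Prod>j\<in>M - V. if j \<in> U then y j * \<xi> j else min (y j) (\<xi> j)))"
      if y: "y \<in> open_cube (M - V)" for y
    proof -
      let ?z = "\<lambda>i. if i \<in> V then 1 else y i"
      have "?z \<in> A"
      proof -
        have "?z \<in> PiE M (\<lambda>_. {0..1})"
        proof (rule PiE_I)
          show "?z i \<in> {0..1}" if "i \<in> M" for i
            using PiE_mem[OF y[unfolded open_cube_def], of i] that by auto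
          show "?z i = undefined" if "i \<notin> M" for i
            using PiE_arb[OF y[unfolded open_cube_def], of i] that V(1) by auto
        qed
        then show ?thesis using \<epsilon>(1) by (simp add: A_def unit_cube_def)
      qed
      then have "mixed_deriv V (\<lambda>x. green M \<M> a x \<xi>) ?z = D (\<lambda>j. if j \<in> V then 1 else 0) ?z"
        by (intro mixed_deriv_jet[OF D A] green finV)
      also have "\<dots> = (\<Sum>U\<in>?S. d U * (\<Prod>j\<in>M - V. if j \<in> U then y j * \<xi> j else min (y j) (\<xi> j)))"
        unfolding D_def
      proof (rule sum.cong)
        fix U
        have "(\<Prod>j\<in>M. g U j (if j \<in> V then 1 else 0) (?z j))
            = (\<Prod>j\<in>M - V. g U j (if j \<in> V then 1 else 0) (?z j)) *
              (\<Prod>j\<in>V. g U j (if j \<in> V then 1 else 0) (?z j))"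
          by (rule prod.subset_diff[OF V(1) finM])
        also have "(\<Prod>j\<in>V. g U j (if j \<in> V then 1 else 0) (?z j)) = (\<Prod>j\<in>V. g U j 1 1)"
          by (intro prod.cong) auto
        also have "(\<Prod>j\<in>M - V. g U j (if j \<in> V then 1 else 0) (?z j))
            = (\<Prod>j\<in>M - V. if j \<in> U then y j * \<xi> j else min (y j) (\<xi> j))"
          by (intro prod.cong) (auto simp: g_def)
        finally show "green_coeff a U * (\<Prod>j\<in>M. g U j (if j \<in> V then 1 else 0) (?z j))
            = d U * (\<Prod>j\<in>M - V. if j \<in> U then y j * \<xi> j else min (y j) (\<xi> j))"
          by (simp add: d_def)
      qed simp
      finally show ?thesis .
    qed
    then have "distr_second_deriv (M - V) (regular_distr (M - V)
        (\<lambda>y. mixed_deriv V (\<lambda>x. green M \<M> a x \<xi>) (\<lambda>i. if i \<in> V then 1 else y i))) \<phi>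
      = (\<Sum>U\<in>?S. d U * (\<Prod>j\<in>M - V. if j \<in> U then 0 else - 1)) * \<phi> (restrict \<xi> (M - V))"
      by (intro distr_second_deriv_sum_prod[OF finite_Diff[OF finM] second_kernel_factor \<phi>]) simp_all
    also have "(\<Sum>U\<in>?S. d U * (\<Prod>j\<in>M - V. if j \<in> U then 0 else - 1 :: real)) = 0"
    proof (intro sum.neutral ballI)
      fix U assume U: "U \<in> ?S"
      show "d U * (\<Prod>j\<in>M - V. if j \<in> U then 0 else - 1) = 0"
      proof (cases "V \<subseteq> U")
        case True
        with U V(2) have "U \<in> \<M>" by blast
        then have "U \<noteq> V" "U \<subseteq> M" using V(3) family by auto
        with True obtain j where "j \<in> U - V" "U \<subseteq> M" by blast
        then have "(\<Prod>j\<in>M - V. if j \<in> U then 0 else - 1 :: real) = 0"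
          using finM by (intro prod_zero) auto
        then show ?thesis by simp
      next
        case False
        then obtain i where "i \<in> V - U" by blast
        then have "(\<Prod>j\<in>V. g U j 1 1) = 0"
          using finV by (intro prod_zero) (auto simp: g_def)
        then show ?thesis by (simp add: d_def)
      qed
    qed
    finally show ?thesis by simp
  qed
  ultimately show ?thesis
    unfolding natural_bc_def using \<epsilon>(1) by (auto simp: A_def)
qed

end

theorem theorem1:
  fixes m :: nat and M :: "nat set" and \<M> :: "nat set set"
    and a :: "nat set \<Rightarrow> real" and \<xi> :: "nat \<Rightarrow> real"
  assumes "m \<ge> 2"
    and M: "M = {1..m}"
    and family: "\<M> \<subseteq> Pow M - {{}}"
    and upward_closed: "\<And>U V. U \<in> \<M> \<Longrightarrow> U \<subseteq> V \<Longrightarrow> V \<subseteq> M \<Longrightarrow> V \<in> \<M>"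
    and coeffs: "\<And>U. U \<in> \<M> \<Longrightarrow> (\<Sum>V\<in>{V \<in> \<M>. V \<subseteq> U}. a V) = 1"
    and \<xi>: "\<xi> \<in> open_cube M"
  shows
    "(\<forall>\<phi>. test_fun M \<phi> \<longrightarrow>
        (-1) ^ m * distr_second_deriv M (regular_distr M (\<lambda>x. green M \<M> a x \<xi>)) \<phi>
          = dirac_distr \<xi> \<phi>) \<and>
     (\<lambda>x. green M \<M> a x \<xi>) \<in> H_space_bc M \<M> \<and>
     (\<forall>V. V \<subseteq> M \<longrightarrow> V \<noteq> {} \<longrightarrow> V \<notin> \<M> \<longrightarrow> natural_bc M V (\<lambda>x. green M \<M> a x \<xi>))"
proof -
  have fin: "finite M" and card: "card M = m" by (simp_all add: M)
  have "green M \<M> a x \<xi> = 0" if "U \<in> \<M>" "\<forall>i\<in>U. x i = 1" for U x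
    using that \<xi>_bounds(2)[OF fin family \<xi>]
    by (intro green_face[OF fin family upward_closed coeffs]) (auto simp: less_imp_le)
  then show ?thesis
    using green_equation[OF fin family \<xi>, of _ a] green_in_H_space[OF fin family \<xi>, of a]
      green_natural_bc[OF fin family \<xi>, of _ a]
    unfolding card by (auto simp: H_space_bc_def)
qed

end
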